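(* A norm on a real or complex vector space is a regular value (on the additive group of the space). Moreover, for any normed vector space $(E,\|\cdot\|)$ over the field $\mathbb{K}\in\{\mathbb{R},\mathbb{C}\}$ the assignment $$E^* \ni u \mapsto \pi\circ(\operatorname{Re} u)\in E'$$ defines an isometric group isomorphism from the dual Banach space $E^*$ of $E$ onto the metric-dual group $E'$ of $E$, where $\pi\colon\mathbb{R}\to\mathbb{T}$ is given by $\pi(t)=e^{2\pi t i}$. In particular, $E$ is a reflexive metric group iff it is a reflexive Banach space.
   Context: $\mathbb{T}=\{z\in\mathbb{C}:|z|=1\}$ is the circle group and $\lambda(z)=\min\{|t|: t\in\mathbb{R},\ e^{2\pi t i}=z\}$ for $z\in\mathbb{T}$. A value on a group $(G,\cdot)$ is a function $p\colon G\to[0,\infty)$ such that $(x,y)\mapsto p(x^{-1}y)$ is a metric on $G$. An Abelian group $(G,+)$ with a value $p$ (a metric Abelian group $(G,+,p)$) is regarded as a topological group with the topology induced by this metric. A norm on a vector space is a value on its additive group. For a metric Abelian group $(G,+,p)$, $G'$ is the group of all continuous homomorphisms from $G$ into $\mathbb{T}$ (with pointwise multiplication), equipped with the dual value $p'(\chi)=\inf\{M>0:\ \lambda(\chi(x))\le M p(x)\ \text{for all } x\in G\}$ (this is a finite-valued value on $G'$); $(G',\cdot,p')$ is called the metric-dual group of $(G,+,p)$. For a normed space $E$, $E'$ is the metric-dual group of $(E,+,\|\cdot\|)$. Iterating, $(G'',\cdot,p'')=(G',\cdot,p')'$. The canonical homomorphism $\kappa_G\colon G\to G''$ is $\kappa_G(x)=\mathfrak{e}_x$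 with $\mathfrak{e}_x(\chi)=\chi(x)$. The value $p$ (and the metric group $(G,+,p)$) is called regular if $\kappa_G$ is isometric (i.e. $p''(\mathfrak{e}_x)=p(x)$ for all $x\in G$), and reflexive if $\kappa_G$ is both isometric and surjective. *)

theory Defs
  imports "HOL-Analysis.Analysis" "HOL-Algebra.Module"
begin

section \<open>The circle group\<close>

definition circle_proj :: "real \<Rightarrow> complex" where
  "circle_proj t = exp (2 * of_real pi * of_real t * \<i>)"

definition circle_group :: "complex monoid" where
  "circle_group = \<lparr>carrier = sphere 0 1, monoid.mult = (*), one = 1\<rparr>"

text \<open>The minimum exists only for \<open>z\<close> on the unit circle; elsewhere the value is arbitrary.\<close>

definition circle_abs :: "complex \<Rightarrow> real" where
  "circle_abs z = (LEAST r. \<exists>t::real. r = \<bar>t\<bar> \<and> circle_proj t = z)"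


section \<open>Groups with a value\<close>

text \<open>The locale \<^locale>\<open>Metric_space\<close> demands nonnegativity and symmetry on the whole type,
  hence the default value \<open>0\<close> outside the carrier.\<close>

definition value_dist :: "('a, 'm) monoid_scheme \<Rightarrow> ('a \<Rightarrow> real) \<Rightarrow> 'a \<Rightarrow> 'a \<Rightarrow> real" where
  "value_dist G p x y =
     (if x \<in> carrier G \<and> y \<in> carrier G then p (inv\<^bsub>G\<^esub> x \<otimes>\<^bsub>G\<^esub> y) else 0)"

definition group_value :: "('a, 'm) monoid_scheme \<Rightarrow> ('a \<Rightarrow> real) \<Rightarrow> bool" where
  "group_value G p \<longleftrightarrow>
     group G \<and> (\<forall>x\<in>carrier G. 0 \<le> p x) \<and> Metric_space (carrier G) (value_dist G p)"

definition metric_abelian_group :: "('a, 'm) monoid_scheme \<Rightarrow> ('a \<Rightarrow> real) \<Rightarrow> bool" where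
  "metric_abelian_group G p \<longleftrightarrow> comm_group G \<and> group_value G p"

definition value_topology :: "('a, 'm) monoid_scheme \<Rightarrow> ('a \<Rightarrow> real) \<Rightarrow> 'a topology" where
  "value_topology G p = Metric_space.mtopology (carrier G) (value_dist G p)"

text \<open>Characters are taken to be extensional, so that equality on \<^term>\<open>carrier G\<close> is equality;
  this matters for iteration, since the carrier of a dual group is never the whole type.\<close>

definition dual_group :: "('a, 'm) monoid_scheme \<Rightarrow> ('a \<Rightarrow> real) \<Rightarrow> ('a \<Rightarrow> complex) monoid" where
  "dual_group G p =
     \<lparr>carrier = {\<phi> \<in> extensional (carrier G). \<phi> \<in> hom G circle_group \<and>
                  continuous_map (value_topology G p) (top_of_set (sphere 0 1)) \<phi>},
      monoid.mult = (\<lambda>\<phi> \<psi>. \<lambda>x\<in>carrier G. \<phi> x * \<psi> x),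
      one = (\<lambda>x\<in>carrier G. 1)\<rparr>"

definition dual_value :: "('a, 'm) monoid_scheme \<Rightarrow> ('a \<Rightarrow> real) \<Rightarrow> ('a \<Rightarrow> complex) \<Rightarrow> real" where
  "dual_value G p \<phi> = Inf {M. 0 < M \<and> (\<forall>x\<in>carrier G. circle_abs (\<phi> x) \<le> M * p x)}"

abbreviation bidual_group ::
    "('a, 'm) monoid_scheme \<Rightarrow> ('a \<Rightarrow> real) \<Rightarrow> (('a \<Rightarrow> complex) \<Rightarrow> complex) monoid" where
  "bidual_group G p \<equiv> dual_group (dual_group G p) (dual_value G p)"

abbreviation bidual_value ::
    "('a, 'm) monoid_scheme \<Rightarrow> ('a \<Rightarrow> real) \<Rightarrow> (('a \<Rightarrow> complex) \<Rightarrow> complex) \<Rightarrow> real" where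
  "bidual_value G p \<equiv> dual_value (dual_group G p) (dual_value G p)"

definition canonical_hom ::
    "('a, 'm) monoid_scheme \<Rightarrow> ('a \<Rightarrow> real) \<Rightarrow> 'a \<Rightarrow> ('a \<Rightarrow> complex) \<Rightarrow> complex" where
  "canonical_hom G p x = (\<lambda>\<phi>\<in>carrier (dual_group G p). \<phi> x)"

definition regular_metric_group :: "('a, 'm) monoid_scheme \<Rightarrow> ('a \<Rightarrow> real) \<Rightarrow> bool" where
  "regular_metric_group G p \<longleftrightarrow> metric_abelian_group G p \<and>
     (\<forall>x\<in>carrier G. bidual_value G p (canonical_hom G p x) = p x)"

definition reflexive_metric_group :: "('a, 'm) monoid_scheme \<Rightarrow> ('a \<Rightarrow> real) \<Rightarrow> bool" where
  "reflexive_metric_group G p \<longleftrightarrow> regular_metric_group G p \<and>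
     canonical_hom G p ` carrier G = carrier (bidual_group G p)"


section \<open>Real and complex normed spaces\<close>

text \<open>Vector spaces are modules with explicit carriers over the subfield \<open>K = \<real>\<close> or \<open>K = UNIV\<close> of
  the complex numbers, so that both cases are treated uniformly and \<open>E\<^sup>*\<close> is again such a space.\<close>

definition scalar_field :: "complex set \<Rightarrow> complex ring" where
  "scalar_field K = \<lparr>carrier = K, monoid.mult = (*), one = 1, zero = 0, add = (+)\<rparr>"

definition normed_space ::
    "complex set \<Rightarrow> (complex, 'a) module \<Rightarrow> ('a \<Rightarrow> real) \<Rightarrow> bool" where
  "normed_space K E N \<longleftrightarrow>
     Module.module (scalar_field K) E \<and>
     (\<forall>x\<in>carrier E. 0 \<le> N x) \<and>
     (\<forall>x\<in>carrier E. N x = 0 \<longleftrightarrow> x = \<zero>\<^bsub>E\<^esub>) \<and>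
     (\<forall>c\<in>K. \<forall>x\<in>carrier E. N (c \<odot>\<^bsub>E\<^esub> x) = cmod c * N x) \<and>
     (\<forall>x\<in>carrier E. \<forall>y\<in>carrier E. N (x \<oplus>\<^bsub>E\<^esub> y) \<le> N x + N y)"

text \<open>The ring fields \<^const>\<open>monoid.mult\<close> and \<^const>\<open>one\<close> of the record play no role in a module.\<close>

definition dual_space ::
    "complex set \<Rightarrow> (complex, 'a) module \<Rightarrow> ('a \<Rightarrow> real) \<Rightarrow> (complex, 'a \<Rightarrow> complex) module" where
  "dual_space K E N =
     \<lparr>carrier = {u \<in> carrier E \<rightarrow>\<^sub>E K.
        (\<forall>x\<in>carrier E. \<forall>y\<in>carrier E. u (x \<oplus>\<^bsub>E\<^esub> y) = u x + u y) \<and>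
        (\<forall>c\<in>K. \<forall>x\<in>carrier E. u (c \<odot>\<^bsub>E\<^esub> x) = c * u x) \<and>
        (\<exists>B. \<forall>x\<in>carrier E. cmod (u x) \<le> B * N x)},
      monoid.mult = undefined,
      one = undefined,
      zero = (\<lambda>x\<in>carrier E. 0),
      add = (\<lambda>u v. \<lambda>x\<in>carrier E. u x + v x),
      smult = (\<lambda>c u. \<lambda>x\<in>carrier E. c * u x)\<rparr>"

definition dual_norm ::
    "(complex, 'a) module \<Rightarrow> ('a \<Rightarrow> real) \<Rightarrow> ('a \<Rightarrow> complex) \<Rightarrow> real" where
  "dual_norm E N u = (SUP x\<in>{x \<in> carrier E. N x \<le> 1}. cmod (u x))"

abbreviation bidual_space ::
    "complex set \<Rightarrow> (complex, 'a) module \<Rightarrow> ('a \<Rightarrow> real) \<Rightarrow>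
      (complex, ('a \<Rightarrow> complex) \<Rightarrow> complex) module" where
  "bidual_space K E N \<equiv> dual_space K (dual_space K E N) (dual_norm E N)"

definition canonical_embedding ::
    "complex set \<Rightarrow> (complex, 'a) module \<Rightarrow> ('a \<Rightarrow> real) \<Rightarrow> 'a \<Rightarrow> ('a \<Rightarrow> complex) \<Rightarrow> complex" where
  "canonical_embedding K E N x = (\<lambda>u\<in>carrier (dual_space K E N). u x)"

definition banach_space ::
    "complex set \<Rightarrow> (complex, 'a) module \<Rightarrow> ('a \<Rightarrow> real) \<Rightarrow> bool" where
  "banach_space K E N \<longleftrightarrow> normed_space K E N \<and>
     Metric_space.mcomplete (carrier E) (value_dist (add_monoid E) N)"

definition reflexive_banach_space ::
    "complex set \<Rightarrow> (complex, 'a) module \<Rightarrow> ('a \<Rightarrow> real) \<Rightarrow> bool" where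
  "reflexive_banach_space K E N \<longleftrightarrow> banach_space K E N \<and>
     canonical_embedding K E N ` carrier E = carrier (bidual_space K E N)"

definition functional_to_character ::
    "(complex, 'a) module \<Rightarrow> ('a \<Rightarrow> complex) \<Rightarrow> 'a \<Rightarrow> complex" where
  "functional_to_character E u = (\<lambda>x\<in>carrier E. circle_proj (Re (u x)))"

end

theory Submission
  imports Defs
begin

text \<open>
  The circle looks like the real line near \<open>1\<close>: on \<open>[-1/4, 1/4]\<close> the function \<^const>\<open>circle_abs\<close>
  takes \<^term>\<open>circle_proj t\<close> to \<open>\<bar>t\<bar>\<close>, and for every \<open>t\<close> to at most \<open>\<bar>t\<bar>\<close>. In a vector space every
  vector can be scaled down until only this range matters, so an estimate
  \<open>circle_abs (circle_proj (f x)) \<le> M * N x\<close> valid for all \<open>x\<close> is the same as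
  \<open>\<bar>f x\<bar> \<le> M * N x\<close> when \<open>f\<close> is homogeneous (\<open>abs_le_if_circle_abs_scaled_le\<close>). Scaling equally
  makes \<open>f\<close> recoverable from \<open>circle_proj \<circ> f\<close> (\<open>circle_proj_scaled_inject\<close>). Hence
  \<open>u \<mapsto> circle_proj \<circ> Re u\<close> is injective and carries the dual norm to the dual value, a functional
  over \<open>K\<close> having the same norm as its real part.

  It is onto because a character restricted to a line \<open>\<real> x\<close> is a continuous homomorphism from
  \<open>\<real>\<close> to the circle, and these all have the form \<open>s \<mapsto> circle_proj (s * t)\<close>
  (\<open>one_parameter_character\<close>). The unique \<open>t\<close> depends linearly on \<open>x\<close> by uniqueness, and boundedly by
  continuity, so it is the real part of a functional.

  Under this isomorphism the bidual value of the evaluation at \<open>a\<close> is the supremum of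
  \<open>\<bar>Re (u a)\<bar>\<close> over the unit ball of the dual space, and regularity is the Hahn-Banach
  theorem. It is obtained from Zorn's lemma applied to sublinear functionals on the whole space rather
  than to partially defined linear ones: a minimal sublinear functional is linear.

  For reflexivity the isomorphism is used twice, for \<open>E\<close> and for its dual space. It identifies
  the two biduals compatibly with the two canonical maps (\<open>eval_char_image_iff\<close>), so one of the maps is onto
  exactly when the other is. The remaining part of being a reflexive Banach space is completeness,
  and this follows from surjectivity: a Cauchy sequence in \<open>E\<close> converges pointwise on the dual space, its
  pointwise limit is a bounded functional there, hence an evaluation at a point, and that point is
  the limit of the sequence.
\<close>

section \<open>The circle and its one-parameter subgroups\<close>

lemma circle_proj_add: "circle_proj (s + t) = circle_proj s * circle_proj t"
  by (simp add: circle_proj_def algebra_simps exp_add)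

lemma circle_proj_0 [simp]: "circle_proj 0 = 1"
  by (simp add: circle_proj_def)

lemma norm_circle_proj [simp]: "cmod (circle_proj t) = 1"
  by (simp add: circle_proj_def)

lemma circle_proj_eq_iff: "circle_proj s = circle_proj t \<longleftrightarrow> s - t \<in> \<int>"
proof -
  have "circle_proj s = circle_proj t \<longleftrightarrow> (\<exists>n::int. 2 * pi * s = 2 * pi * t + of_int (2 * n) * pi)"
    unfolding circle_proj_def exp_eq by (simp add: complex_eq_iff)
  also have "\<dots> \<longleftrightarrow> (\<exists>n::int. s - t = of_int n)"
  proof (rule ex_cong1)
    fix n :: int
    have "2 * pi * s = 2 * pi * t + of_int (2 * n) * pi \<longleftrightarrow> 2 * pi * (s - t - of_int n) = 0"
      by (simp add: algebra_simps)
    then show "2 * pi * s = 2 * pi * t + of_int (2 * n) * pi \<longleftrightarrow> s - t = of_int n"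
      by simp
  qed
  finally show ?thesis
    by (auto elim: Ints_cases)
qed

lemma continuous_on_circle_proj [continuous_intros]:
  "continuous_on A f \<Longrightarrow> continuous_on A (\<lambda>x. circle_proj (f x))"
  unfolding circle_proj_def by (intro continuous_intros)

text \<open>The real numbers with a given image on the circle form a coset of the integers, and rounding picks the
  member of it nearest to \<open>0\<close>.\<close>

lemma circle_abs_circle_proj: "circle_abs (circle_proj t) = \<bar>t - of_int (round t)\<bar>"
  unfolding circle_abs_def
proof (rule Least_equality)
  show "\<exists>s. \<bar>t - of_int (round t)\<bar> = \<bar>s\<bar> \<and> circle_proj s = circle_proj t"
    by (rule exI[of _ "t - of_int (round t)"]) (simp add: circle_proj_eq_iff)
next
  fix r assume "\<exists>s. r = \<bar>s\<bar> \<and> circle_proj s = circle_proj t"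
  then obtain s where s: "r = \<bar>s\<bar>" "t - s \<in> \<int>"
    by (metis circle_proj_eq_iff)
  then obtain n :: int where "t - s = of_int n"
    by (auto elim: Ints_cases)
  then have "s = t - of_int n" by simp
  then show "\<bar>t - of_int (round t)\<bar> \<le> r"
    using s(1) round_diff_minimal[of t n] by simp
qed

lemma circle_abs_circle_proj_le: "circle_abs (circle_proj t) \<le> \<bar>t\<bar>"
  using round_diff_minimal[of t 0] by (simp add: circle_abs_circle_proj)

lemma circle_abs_circle_proj_small:
  assumes "\<bar>t\<bar> \<le> 1 / 4"
  shows "circle_abs (circle_proj t) = \<bar>t\<bar>"
proof -
  have "round t = 0"
    unfolding round_def floor_eq_iff using assms by (auto simp: abs_le_iff)
  then show ?thesis
    by (simp add: circle_abs_circle_proj)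
qed

text \<open>Passage from the circle back to the line: for small \<open>s\<close> the number \<open>s * a\<close> lies in the
  range where the projection is isometric, and then \<open>s\<close> cancels.\<close>

lemma abs_le_if_circle_abs_scaled_le:
  assumes "\<And>s. 0 < s \<Longrightarrow> circle_abs (circle_proj (s * a)) \<le> s * b"
  shows "\<bar>a\<bar> \<le> b"
proof -
  \<comment> \<open>The summand \<open>1\<close> keeps the denominator positive for \<open>a = 0\<close>.\<close>
  define s where "s = 1 / (4 * (\<bar>a\<bar> + 1))"
  have s: "0 < s" "s * \<bar>a\<bar> \<le> 1 / 4"
    by (auto simp: s_def field_simps)
  then have "s * \<bar>a\<bar> \<le> s * b"
    using assms[OF s(1)] circle_abs_circle_proj_small[of "s * a"] by (simp add: abs_mult)
  then show ?thesis
    using s(1) by simp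
qed

text \<open>A single value of the projection leaves \<open>a - b\<close> undetermined up to an integer; scaling
  removes this ambiguity, by the estimate above with \<open>b = 0\<close>. This is the uniqueness principle behind both the injectivity of
  \<^const>\<open>functional_to_character\<close> and the linearity of the lift of a character.\<close>

lemma circle_proj_scaled_inject:
  assumes "\<And>s. circle_proj (s * a) = circle_proj (s * b)"
  shows "a = b"
proof -
  have "\<bar>a - b\<bar> \<le> 0"
  proof (rule abs_le_if_circle_abs_scaled_le)
    fix s :: real
    have "circle_proj (s * (a - b)) = circle_proj 0"
      using assms[of s] by (simp only: circle_proj_eq_iff) (simp add: algebra_simps)
    then show "circle_abs (circle_proj (s * (a - b))) \<le> s * 0"
      using circle_abs_circle_proj_le[of 0] by simp
  qed
  then show ?thesis by simp
qed

text \<open>Additivity alone gives linearity over the rationals, which are dense.\<close>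

lemma additive_continuous_imp_linear:
  fixes g :: "real \<Rightarrow> real"
  assumes cont: "continuous_on UNIV g" and add: "\<And>s t. g (s + t) = g s + g t"
  shows "g s = s * g 1"
proof -
  have of_nat: "g (real n * t) = real n * g t" for n t
  proof (induction n)
    case 0
    show ?case using add[of 0 0] by simp
  next
    case (Suc n)
    then show ?case by (simp add: algebra_simps add)
  qed
  have neg: "g (- t) = - g t" for t
    using add[of t "- t"] add[of 0 0] by simp
  have of_int: "g (of_int k * t) = of_int k * g t" for k t
    by (cases k rule: int_cases2) (simp_all add: of_nat neg)
  have rat: "g s - s * g 1 = 0" if "s \<in> \<rat>" for s
  proof -
    from that obtain a b :: int where ab: "b > 0" "s = of_int a / of_int b"
      by (rule Rats_cases')
    have "of_int b * g s = of_int a * g 1"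
      using of_int[of b s] of_int[of a 1] ab by simp
    then have "g s = of_int a * g 1 / of_int b"
      using ab(1) by (simp add: field_simps)
    then show ?thesis
      by (simp add: ab(2))
  qed
  have "g s - s * g 1 = 0"
  proof (rule continuous_constant_on_closure[where S = "\<rat>" and f = "\<lambda>s. g s - s * g 1"])
    show "continuous_on (closure \<rat>) (\<lambda>s. g s - s * g 1)"
      by (intro continuous_intros continuous_on_subset[OF cont]) auto
    show "s \<in> closure \<rat>"
      by (simp add: Rats_closure_real)
  qed (rule rat)
  then show ?thesis by simp
qed

text \<open>The real line is contractible, so \<open>h\<close> has a continuous logarithm. Its failure to be additive is an
  integer depending continuously on the arguments, hence constant; subtracting the constant leaves a
  continuous additive function.\<close>

lemma one_parameter_character:
  fixes h :: "real \<Rightarrow> complex"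
  assumes cont: "continuous_on UNIV h"
    and mult: "\<And>s t. h (s + t) = h s * h t"
    and norm1: "\<And>s. cmod (h s) = 1"
  obtains t where "\<And>s. h s = circle_proj (s * t)"
proof -
  have nz: "h s \<noteq> 0" for s
    using norm1[of s] by auto
  obtain l where l: "continuous_on UNIV l" "\<And>s. h s = exp (l s)"
    using continuous_logarithm_on_contractible[OF cont] nz convex_imp_contractible[of "UNIV::real set"]
    by (metis UNIV_I convex_UNIV)
  define g where "g s = Im (l s) / (2 * pi)" for s
  have contg: "continuous_on UNIV g"
    unfolding g_def by (intro continuous_intros l(1)) auto
  have hg: "h s = circle_proj (g s)" for s
  proof -
    have "Re (l s) = 0"
      using norm1[of s] by (simp add: l(2))
    then have "l s = 2 * of_real pi * of_real (g s) * \<i>"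
      by (simp add: g_def complex_eq_iff)
    then show ?thesis
      by (simp add: circle_proj_def l(2))
  qed
  have defect: "g (s + t) - g s - g t = - g 0" for s t
  proof -
    have "(\<lambda>s. g (s + t) - g s - g t) constant_on UNIV"
    proof (rule continuous_discrete_range_constant)
      show "continuous_on UNIV (\<lambda>s. g (s + t) - g s - g t)"
        by (intro continuous_intros continuous_on_compose2[OF contg] contg) auto
      have int: "g (s + t) - g s - g t \<in> \<int>" for s
        using mult[of s t] by (simp add: hg circle_proj_add[symmetric] circle_proj_eq_iff algebra_simps)
      have "1 \<le> norm ((g (u + t) - g u - g t) - (g (s + t) - g s - g t))"
        if "g (u + t) - g u - g t \<noteq> g (s + t) - g s - g t" for s u
        using Ints_nonzero_abs_ge1[OF Ints_diff[OF int[of u] int[of s]]] that by simp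
      then show "\<exists>e>0. \<forall>u. u \<in> UNIV \<and> g (u + t) - g u - g t \<noteq> g (s + t) - g s - g t \<longrightarrow>
          e \<le> norm (g (u + t) - g u - g t - (g (s + t) - g s - g t))" for s
        by (intro exI[of _ 1]) simp
    qed auto
    then obtain c where "\<And>s. g (s + t) - g s - g t = c"
      unfolding constant_on_def by blast
    from this[of s] this[of 0] show ?thesis by simp
  qed
  have "h 0 = 1"
    using mult[of 0 0] nz[of 0] by simp
  then have g0: "circle_proj (g 0) = 1"
    by (simp add: hg)
  have lin: "g s - g 0 = s * (g 1 - g 0)" for s
    by (rule additive_continuous_imp_linear[where g = "\<lambda>s. g s - g 0"])
      (use defect in \<open>auto intro!: continuous_intros contg simp: algebra_simps\<close>)
  have "h s = circle_proj (s * (g 1 - g 0))" for s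
    using circle_proj_add[of "g s - g 0" "g 0"] by (simp add: g0 hg flip: lin)
  then show thesis by (rule that)
qed

section \<open>Characters and dual values of groups with a value\<close>

lemma group_valueI:
  fixes G (structure)
  assumes "group G"
    and nonneg: "\<And>x. x \<in> carrier G \<Longrightarrow> 0 \<le> p x"
    and eq_0: "\<And>x. x \<in> carrier G \<Longrightarrow> p x = 0 \<longleftrightarrow> x = \<one>"
    and inv: "\<And>x. x \<in> carrier G \<Longrightarrow> p (inv x) = p x"
    and subadd: "\<And>x y. x \<in> carrier G \<Longrightarrow> y \<in> carrier G \<Longrightarrow> p (x \<otimes> y) \<le> p x + p y"
  shows "group_value G p"
proof -
  interpret group G by fact
  have "Metric_space (carrier G) (value_dist G p)"
  proof
    fix x y z
    show "0 \<le> value_dist G p x y"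
      by (simp add: value_dist_def nonneg)
    show "value_dist G p x y = value_dist G p y x"
      using inv[of "inv x \<otimes> y"] by (auto simp: value_dist_def inv_mult_group)
    assume xyz: "x \<in> carrier G" "y \<in> carrier G"
    show "value_dist G p x y = 0 \<longleftrightarrow> x = y"
      using xyz by (auto simp: value_dist_def eq_0) (metis inv_equality inv_inv inv_closed)
    assume z: "z \<in> carrier G"
    have "y \<otimes> (inv y \<otimes> z) = z"
      using xyz z by (simp flip: m_assoc)
    then have "inv x \<otimes> z = (inv x \<otimes> y) \<otimes> (inv y \<otimes> z)"
      using xyz z by (simp add: m_assoc)
    then show "value_dist G p x z \<le> value_dist G p x y + value_dist G p y z"
      using xyz z by (simp add: value_dist_def subadd del: m_assoc)
  qed
  then show ?thesis
    by (simp add: group_value_def \<open>group G\<close> nonneg)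
qed

lemma group_value_dist:
  assumes "group_value G p" "x \<in> carrier G"
  shows "value_dist G p \<one>\<^bsub>G\<^esub> x = p x"
proof -
  interpret group G using assms(1) by (simp add: group_value_def)
  show ?thesis using assms(2) by (simp add: value_dist_def)
qed

lemma circle_group_simps [simp]:
  "carrier circle_group = sphere 0 1" "monoid.mult circle_group = (*)" "one circle_group = 1"
  by (simp_all add: circle_group_def)

lemma group_circle_group: "group circle_group"
  by (rule groupI) (auto simp: norm_mult norm_inverse intro!: bexI[of _ "inverse _"] left_inverse)

text \<open>Translation invariance of the distance and \<open>\<bar>\<phi> a\<bar> = 1\<close> reduce continuity to
  continuity at the neutral element. In this form the topology of the group no longer has to be mentioned.\<close>

lemma character_continuous_iff:
  fixes G (structure)
  assumes p: "group_value G p" and \<phi>: "\<phi> \<in> hom G circle_group"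
  shows "continuous_map (value_topology G p) (top_of_set (sphere 0 1)) \<phi> \<longleftrightarrow>
    (\<forall>\<epsilon>>0. \<exists>\<delta>>0. \<forall>x\<in>carrier G. p x < \<delta> \<longrightarrow> cmod (\<phi> x - 1) < \<epsilon>)"
    (is "?cont \<longleftrightarrow> ?at_1")
proof -
  interpret group G using p by (simp add: group_value_def)
  interpret Metric_space "carrier G" "value_dist G p" using p by (simp add: group_value_def)
  interpret \<phi>: group_hom G circle_group \<phi>
    using \<phi> group_circle_group by (simp add: group_hom_def group_hom_axioms_def group_axioms)
  have norm1: "cmod (\<phi> x) = 1" if "x \<in> carrier G" for x
    using \<phi>.hom_closed[OF that] by simp
  have diff: "cmod (\<phi> x - \<phi> a) = cmod (\<phi> (inv a \<otimes> x) - 1)" if "a \<in> carrier G" "x \<in> carrier G" for a x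
  proof -
    have "a \<otimes> (inv a \<otimes> x) = x"
      using that by (simp flip: m_assoc)
    then have "\<phi> x - \<phi> a = \<phi> a * (\<phi> (inv a \<otimes> x) - 1)"
      using \<phi>.hom_mult[of a "inv a \<otimes> x"] that by (simp add: algebra_simps)
    then show ?thesis
      using norm1[OF that(1)] by (simp add: norm_mult)
  qed
  have "?cont \<longleftrightarrow> continuous_map mtopology euclidean \<phi>"
    using norm1 by (auto simp: value_topology_def continuous_map_in_subtopology)
  also have "\<dots> \<longleftrightarrow> (\<forall>a\<in>carrier G. \<forall>\<epsilon>>0. \<exists>\<delta>>0. \<forall>x.
      x \<in> carrier G \<and> value_dist G p a x < \<delta> \<longrightarrow> dist (\<phi> a) (\<phi> x) < \<epsilon>)"
    using metric_continuous_map[OF Met_TC.Metric_space_axioms, of \<phi>] by simp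
  also have "\<dots> \<longleftrightarrow> ?at_1"
  proof
    assume L: "\<forall>a\<in>carrier G. \<forall>\<epsilon>>0. \<exists>\<delta>>0. \<forall>x.
      x \<in> carrier G \<and> value_dist G p a x < \<delta> \<longrightarrow> dist (\<phi> a) (\<phi> x) < \<epsilon>"
    have "\<phi> \<one> = 1"
      using \<phi>.hom_one by simp
    with bspec[OF L one_closed] show ?at_1
      by (metis dist_norm dist_commute group_value_dist[OF p])
  next
    assume R: ?at_1
    show "\<forall>a\<in>carrier G. \<forall>\<epsilon>>0. \<exists>\<delta>>0. \<forall>x.
      x \<in> carrier G \<and> value_dist G p a x < \<delta> \<longrightarrow> dist (\<phi> a) (\<phi> x) < \<epsilon>"
    proof (intro ballI allI impI)
      fix a and \<epsilon> :: real
      assume a: "a \<in> carrier G" and "0 < \<epsilon>"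
      with R obtain \<delta> where "\<delta> > 0" "\<forall>x\<in>carrier G. p x < \<delta> \<longrightarrow> cmod (\<phi> x - 1) < \<epsilon>"
        by blast
      then show "\<exists>\<delta>>0. \<forall>x. x \<in> carrier G \<and> value_dist G p a x < \<delta> \<longrightarrow> dist (\<phi> a) (\<phi> x) < \<epsilon>"
        using a by (intro exI[of _ \<delta>])
          (auto simp: dist_norm norm_minus_commute[of "\<phi> a"] diff value_dist_def)
    qed
  qed
  finally show ?thesis .
qed

lemma dual_group_simps [simp]:
  "monoid.mult (dual_group G p) = (\<lambda>\<phi> \<psi>. \<lambda>x\<in>carrier G. \<phi> x * \<psi> x)"
  "one (dual_group G p) = (\<lambda>x\<in>carrier G. 1)"
  by (simp_all add: dual_group_def)

lemma dual_group_carrier_iff: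
  assumes "group_value G p"
  shows "\<phi> \<in> carrier (dual_group G p) \<longleftrightarrow> \<phi> \<in> extensional (carrier G) \<and> \<phi> \<in> hom G circle_group \<and>
    (\<forall>\<epsilon>>0. \<exists>\<delta>>0. \<forall>x\<in>carrier G. p x < \<delta> \<longrightarrow> cmod (\<phi> x - 1) < \<epsilon>)"
  using character_continuous_iff[OF assms] by (auto simp: dual_group_def)

text \<open>Used to see that the metric-dual group of a normed space is again a group with a value: it inherits this
  from the dual Banach space. The hypothesis \<open>h1\<close> cannot be derived from \<open>h\<close>, since \<^const>\<open>iso\<close> speaks only of
  the multiplication and \<open>G\<close> is not known to be a group beforehand.\<close>

lemma group_value_iso:
  fixes H (structure)
  assumes q: "group_value H q" and h: "h \<in> iso H G" and h1: "h \<one> = \<one>\<^bsub>G\<^esub>"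
    and p: "\<And>x. x \<in> carrier H \<Longrightarrow> p (h x) = q x"
  shows "group_value G p"
proof -
  interpret H: group H using q by (simp add: group_value_def)
  interpret mH: Metric_space "carrier H" "value_dist H q" using q by (simp add: group_value_def)
  have "group (G\<lparr>one := h \<one>\<rparr>)"
    by (rule H.iso_imp_img_group[OF h])
  then have "group G" by (simp add: h1)
  then interpret G: group G .
  interpret h: group_hom H G h
    using h by (simp add: group_hom_def group_hom_axioms_def iso_def H.group_axioms G.group_axioms)
  have surj: "\<exists>a\<in>carrier H. x = h a" if "x \<in> carrier G" for x
    using h that by (auto simp: iso_def bij_betw_def)
  have inj: "h a = h b \<longleftrightarrow> a = b" if "a \<in> carrier H" "b \<in> carrier H" for a b
    using h that by (auto simp: iso_def bij_betw_def inj_on_def)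
  have dist: "value_dist G p (h a) (h b) = value_dist H q a b" if "a \<in> carrier H" "b \<in> carrier H" for a b
    using that p[of "inv a \<otimes> b"] by (simp add: value_dist_def)
  have "Metric_space (carrier G) (value_dist G p)"
  proof
    fix x y
    have off: "value_dist G p x y = 0" if "x \<notin> carrier G \<or> y \<notin> carrier G" for x y
      using that by (auto simp: value_dist_def)
    show "0 \<le> value_dist G p x y"
      using off[of x y] by (cases "x \<in> carrier G \<and> y \<in> carrier G") (auto dest!: surj simp: dist)
    show "value_dist G p x y = value_dist G p y x"
      using off[of x y] off[of y x]
      by (cases "x \<in> carrier G \<and> y \<in> carrier G") (auto dest!: surj simp: dist mH.commute)
    assume xy: "x \<in> carrier G" "y \<in> carrier G"
    show "value_dist G p x y = 0 \<longleftrightarrow> x = y"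
      using xy by (auto dest!: surj simp: dist inj)
    show "value_dist G p x z \<le> value_dist G p x y + value_dist G p y z" if "z \<in> carrier G" for z
      using xy that by (auto dest!: surj simp: dist mH.triangle)
  qed
  moreover have "0 \<le> p x" if "x \<in> carrier G" for x
    using surj[OF that] q by (auto simp: p group_value_def)
  ultimately show ?thesis
    by (simp add: group_value_def G.group_axioms)
qed

text \<open>Value-preserving homomorphisms are continuous, hence act on characters by composition. Applied to an
  isomorphism and its inverse, this identifies the dual groups.\<close>

lemma dual_group_pullback:
  assumes q: "group_value H q" and p: "group_value G p" and h: "h \<in> hom H G"
    and pq: "\<And>x. x \<in> carrier H \<Longrightarrow> p (h x) = q x"
    and \<phi>: "\<phi> \<in> carrier (dual_group G p)"
  shows "(\<lambda>x\<in>carrier H. \<phi> (h x)) \<in> carrier (dual_group H q)"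
proof -
  interpret H: group H using q by (simp add: group_value_def)
  have hc: "h x \<in> carrier G" if "x \<in> carrier H" for x
    using h that by (auto simp: hom_def)
  have "(\<lambda>x\<in>carrier H. \<phi> (h x)) \<in> hom H circle_group"
    using \<phi> h by (auto simp: dual_group_def hom_def Pi_iff)
  moreover have "\<exists>\<delta>>0. \<forall>x\<in>carrier H. q x < \<delta> \<longrightarrow> cmod (\<phi> (h x) - 1) < \<epsilon>" if "\<epsilon> > 0" for \<epsilon>
    using \<phi> that hc pq unfolding dual_group_carrier_iff[OF p] by metis
  ultimately show ?thesis
    unfolding dual_group_carrier_iff[OF q] by auto
qed

text \<open>The infimum is attained unless it is \<open>0\<close>; the strict inequality in its definition excludes \<open>0\<close> itself.\<close>

lemma dual_value_eqI:
  assumes a: "0 \<le> a"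
    and le: "\<And>M. 0 < M \<Longrightarrow> (\<forall>x\<in>carrier G. circle_abs (\<phi> x) \<le> M * p x) \<longleftrightarrow> a \<le> M"
  shows "dual_value G p \<phi> = a"
proof -
  have "{M. 0 < M \<and> (\<forall>x\<in>carrier G. circle_abs (\<phi> x) \<le> M * p x)} = {M. 0 < M \<and> a \<le> M}"
    using le by auto
  moreover have "Inf {M. 0 < M \<and> a \<le> M} = a"
  proof (rule cInf_eq_non_empty)
    show "{M. 0 < M \<and> a \<le> M} \<noteq> {}"
      using a by (auto intro: exI[of _ "a + 1"])
    show "y \<le> a" if y: "\<And>M. M \<in> {M. 0 < M \<and> a \<le> M} \<Longrightarrow> y \<le> M" for y
    proof (rule field_le_epsilon)
      show "y \<le> a + e" if "0 < e" for e
        using a that y[of "a + e"] by simp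
    qed
  qed auto
  ultimately show ?thesis
    by (simp add: dual_value_def)
qed

section \<open>Normed spaces over the real or complex numbers\<close>

text \<open>Fixing both hypotheses in a locale allows every result to be instantiated again with the dual space in
  the role of \<open>E\<close>.\<close>

locale real_or_complex_normed_space =
  fixes K :: "complex set" and E :: "(complex, 'a) module" (structure) and N :: "'a \<Rightarrow> real"
  assumes real_or_complex: "K = \<real> \<or> K = UNIV"
    and normed: "normed_space K E N"
begin

sublocale module "scalar_field K" E
  using normed by (simp add: normed_space_def)

lemma of_real_in_K [simp]: "complex_of_real t \<in> K"
  using real_or_complex by auto

lemma in_K_simps [simp]: "0 \<in> K" "1 \<in> K"
  using of_real_in_K[of 0] of_real_in_K[of 1] by auto

lemma K_closed:
  "a \<in> K \<Longrightarrow> b \<in> K \<Longrightarrow> a + b \<in> K"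
  "a \<in> K \<Longrightarrow> b \<in> K \<Longrightarrow> a * b \<in> K"
  "a \<in> K \<Longrightarrow> - a \<in> K"
  using real_or_complex by auto

lemma scale_closed [simp]: "c \<in> K \<Longrightarrow> x \<in> carrier E \<Longrightarrow> c \<odot> x \<in> carrier E"
  using smult_closed by (simp add: scalar_field_def)

lemma scale_add_left:
  "a \<in> K \<Longrightarrow> b \<in> K \<Longrightarrow> x \<in> carrier E \<Longrightarrow> (a + b) \<odot> x = a \<odot> x \<oplus> b \<odot> x"
  using smult_l_distr by (simp add: scalar_field_def)

lemma scale_add_right:
  "c \<in> K \<Longrightarrow> x \<in> carrier E \<Longrightarrow> y \<in> carrier E \<Longrightarrow> c \<odot> (x \<oplus> y) = c \<odot> x \<oplus> c \<odot> y"
  using smult_r_distr by (simp add: scalar_field_def)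

lemma scale_scale:
  "a \<in> K \<Longrightarrow> b \<in> K \<Longrightarrow> x \<in> carrier E \<Longrightarrow> a \<odot> (b \<odot> x) = (a * b) \<odot> x"
  using smult_assoc1 by (simp add: scalar_field_def)

lemma scale_one [simp]: "x \<in> carrier E \<Longrightarrow> 1 \<odot> x = x"
  using smult_one by (simp add: scalar_field_def)

lemma scale_zero [simp]: "x \<in> carrier E \<Longrightarrow> 0 \<odot> x = \<zero>"
  using smult_l_null by (simp add: scalar_field_def)

lemma scale_minus_one: "x \<in> carrier E \<Longrightarrow> (- 1) \<odot> x = \<ominus> x"
  using scale_add_left[of "- 1" 1 x] K_closed(3)[of 1]
  by (intro M.minus_equality[symmetric]) auto

lemma norm_nonneg [simp]: "x \<in> carrier E \<Longrightarrow> 0 \<le> N x"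
  and norm_eq_0_iff: "x \<in> carrier E \<Longrightarrow> N x = 0 \<longleftrightarrow> x = \<zero>"
  and norm_scale: "c \<in> K \<Longrightarrow> x \<in> carrier E \<Longrightarrow> N (c \<odot> x) = cmod c * N x"
  and norm_triangle: "x \<in> carrier E \<Longrightarrow> y \<in> carrier E \<Longrightarrow> N (x \<oplus> y) \<le> N x + N y"
  using normed by (simp_all add: normed_space_def)

lemma norm_zero [simp]: "N \<zero> = 0"
  by (simp add: norm_eq_0_iff)

lemma norm_minus [simp]: "x \<in> carrier E \<Longrightarrow> N (\<ominus> x) = N x"
  using norm_scale[of "- 1" x] K_closed(3)[of 1] by (simp add: scale_minus_one)

lemma group_value_norm: "group_value (add_monoid E) N"
  by (rule group_valueI)
    (auto simp: M.a_group norm_eq_0_iff norm_triangle simp flip: a_inv_def)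

definition real_linear :: "('a \<Rightarrow> real) \<Rightarrow> bool" where
  "real_linear f \<longleftrightarrow> (\<forall>x\<in>carrier E. \<forall>y\<in>carrier E. f (x \<oplus> y) = f x + f y) \<and>
     (\<forall>t. \<forall>x\<in>carrier E. f (complex_of_real t \<odot> x) = t * f x)"


section \<open>Norming real-linear functionals\<close>

text \<open>Functions are required to vanish outside the carrier so that the pointwise order on the whole type is
  antisymmetric on sublinear functionals. Positive homogeneity is required only as an inequality,
  which is all that has to be checked for infima; the equality follows by scaling back.\<close>

definition sublinear :: "('a \<Rightarrow> real) \<Rightarrow> bool" where
  "sublinear q \<longleftrightarrow> (\<forall>x. x \<notin> carrier E \<longrightarrow> q x = 0) \<and>
     (\<forall>x\<in>carrier E. \<forall>y\<in>carrier E. q (x \<oplus> y) \<le> q x + q y) \<and>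
     (\<forall>t>0. \<forall>x\<in>carrier E. q (complex_of_real t \<odot> x) \<le> t * q x)"

lemma sublinearD:
  assumes "sublinear q"
  shows "x \<notin> carrier E \<Longrightarrow> q x = 0"
    and "x \<in> carrier E \<Longrightarrow> y \<in> carrier E \<Longrightarrow> q (x \<oplus> y) \<le> q x + q y"
    and "0 < t \<Longrightarrow> x \<in> carrier E \<Longrightarrow> q (complex_of_real t \<odot> x) \<le> t * q x"
  using assms unfolding sublinear_def by auto

lemma sublinear_scale:
  assumes q: "sublinear q" and x: "x \<in> carrier E" and t: "0 \<le> t"
  shows "q (complex_of_real t \<odot> x) = t * q x"
proof (cases "t = 0")
  case True
  have "q \<zero> \<le> 2 * q \<zero>" "q \<zero> \<le> (1 / 2) * q \<zero>"
    using sublinearD(3)[OF q, of 2 "\<zero>"] sublinearD(3)[OF q, of "1/2" "\<zero>"]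
      smult_r_null[of 2] smult_r_null[of "1/2"] of_real_in_K[of 2] of_real_in_K[of "1/2"]
    by (simp_all add: scalar_field_def)
  then have "q \<zero> = 0" by simp
  then show ?thesis using True x by simp
next
  case False
  then have t: "0 < t" using t by simp
  have "x = complex_of_real (1 / t) \<odot> (complex_of_real t \<odot> x)"
    using t x by (simp add: scale_scale del: of_real_divide) simp
  then have "q x \<le> (1 / t) * q (complex_of_real t \<odot> x)"
    using sublinearD(3)[OF q, of "1 / t" "complex_of_real t \<odot> x"] t x by simp
  with sublinearD(3)[OF q t x] t show ?thesis
    by (simp add: field_simps)
qed

lemma sublinear_zero: "sublinear q \<Longrightarrow> q \<zero> = 0"
  using sublinear_scale[of q "\<zero>" 0] by simp

lemma sublinear_lower_bound:
  assumes "sublinear q" "x \<in> carrier E"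
  shows "- q (\<ominus> x) \<le> q x"
  using sublinearD(2)[OF assms(1), of x "\<ominus> x"] sublinear_zero[OF assms(1)] assms(2)
  by (simp add: M.r_neg)

text \<open>A sublinear functional \<open>q\<close> that is not linear can be lowered: \<open>descent a q\<close> is the largest sublinear
  \<open>r \<le> q\<close> with \<open>r (\<ominus> a) \<le> - q a\<close>, that is, the largest one that is odd in the direction
  of \<open>a\<close> and keeps the value at \<open>a\<close>.\<close>

definition descent :: "'a \<Rightarrow> ('a \<Rightarrow> real) \<Rightarrow> 'a \<Rightarrow> real" where
  "descent a q x = (if x \<in> carrier E
     then INF t\<in>{0..}. q (x \<oplus> complex_of_real t \<odot> a) - t * q a else 0)"

text \<open>The point is that the infimum is over a set bounded below, by \<open>- q (\<ominus> x)\<close>.\<close>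

lemma descent_le:
  assumes q: "sublinear q" and a: "a \<in> carrier E" and x: "x \<in> carrier E" and t: "0 \<le> t"
  shows "descent a q x \<le> q (x \<oplus> complex_of_real t \<odot> a) - t * q a"
proof -
  have "- q (\<ominus> x) \<le> q (x \<oplus> complex_of_real t \<odot> a) - t * q a" if "0 \<le> t" for t
  proof -
    have "complex_of_real t \<odot> a = (x \<oplus> complex_of_real t \<odot> a) \<oplus> (\<ominus> x)"
      using x a by (simp add: M.a_ac M.r_neg2 M.r_neg1)
    then show ?thesis
      using sublinearD(2)[OF q, of "x \<oplus> complex_of_real t \<odot> a" "\<ominus> x"] x a
        sublinear_scale[OF q a that] by simp
  qed
  then have "bdd_below ((\<lambda>t. q (x \<oplus> complex_of_real t \<odot> a) - t * q a) ` {0..})"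
    by (auto intro!: bdd_belowI2)
  then show ?thesis
    using x t by (auto simp: descent_def intro: cINF_lower)
qed

lemma descent_greatest:
  assumes "x \<in> carrier E"
    and "\<And>t. 0 \<le> t \<Longrightarrow> m \<le> q (x \<oplus> complex_of_real t \<odot> a) - t * q a"
  shows "m \<le> descent a q x"
  using assms by (auto simp: descent_def intro!: cINF_greatest)

lemma descent_le_self:
  assumes "sublinear q" "a \<in> carrier E"
  shows "descent a q x \<le> q x"
proof (cases "x \<in> carrier E")
  case True
  then show ?thesis using descent_le[OF assms True, of 0] assms(2) by simp
next
  case False
  then show ?thesis using sublinearD(1)[OF assms(1) False] by (simp add: descent_def)
qed

lemma sublinear_descent:
  assumes q: "sublinear q" and a: "a \<in> carrier E"
  shows "sublinear (descent a q)"
  unfolding sublinear_def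
proof (intro conjI allI ballI impI)
  fix x assume "x \<notin> carrier E"
  then show "descent a q x = 0" by (simp add: descent_def)
next
  fix x y assume xy: "x \<in> carrier E" "y \<in> carrier E"
  have "descent a q (x \<oplus> y) - descent a q y \<le> descent a q x"
  proof (rule descent_greatest[OF xy(1)])
    fix s :: real assume s: "0 \<le> s"
    have "descent a q (x \<oplus> y) - (q (x \<oplus> complex_of_real s \<odot> a) - s * q a) \<le> descent a q y"
    proof (rule descent_greatest[OF xy(2)])
      fix t :: real assume t: "0 \<le> t"
      have "(x \<oplus> y) \<oplus> complex_of_real (s + t) \<odot> a
          = (x \<oplus> complex_of_real s \<odot> a) \<oplus> (y \<oplus> complex_of_real t \<odot> a)"
        using xy a by (simp add: scale_add_left M.a_ac)
      then have "q ((x \<oplus> y) \<oplus> complex_of_real (s + t) \<odot> a)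
          \<le> q (x \<oplus> complex_of_real s \<odot> a) + q (y \<oplus> complex_of_real t \<odot> a)"
        using sublinearD(2)[OF q] xy a by simp
      then show "descent a q (x \<oplus> y) - (q (x \<oplus> complex_of_real s \<odot> a) - s * q a)
          \<le> q (y \<oplus> complex_of_real t \<odot> a) - t * q a"
        using descent_le[OF q a, of "x \<oplus> y" "s + t"] xy s t by (simp add: algebra_simps)
    qed
    then show "descent a q (x \<oplus> y) - descent a q y \<le> q (x \<oplus> complex_of_real s \<odot> a) - s * q a"
      by simp
  qed
  then show "descent a q (x \<oplus> y) \<le> descent a q x + descent a q y" by simp
next
  fix s :: real and x assume s: "0 < s" and x: "x \<in> carrier E"
  have "descent a q (complex_of_real s \<odot> x) / s \<le> descent a q x"
  proof (rule descent_greatest[OF x])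
    fix t :: real assume t: "0 \<le> t"
    have "complex_of_real s \<odot> x \<oplus> complex_of_real (s * t) \<odot> a
        = complex_of_real s \<odot> (x \<oplus> complex_of_real t \<odot> a)"
      using x a by (simp add: scale_add_right scale_scale)
    then have "descent a q (complex_of_real s \<odot> x)
        \<le> s * q (x \<oplus> complex_of_real t \<odot> a) - s * t * q a"
      using descent_le[OF q a, of "complex_of_real s \<odot> x" "s * t"] s t x a
        sublinearD(3)[OF q s, of "x \<oplus> complex_of_real t \<odot> a"] by simp
    then show "descent a q (complex_of_real s \<odot> x) / s
        \<le> q (x \<oplus> complex_of_real t \<odot> a) - t * q a"
      using s by (simp add: field_simps)
  qed
  then show "descent a q (complex_of_real s \<odot> x) \<le> s * descent a q x"
    using s by (simp add: field_simps)
qed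

text \<open>By minimality \<open>q = descent a q\<close>, and the term \<open>t = 1\<close> of the infimum gives
  \<open>q x \<le> q (x \<oplus> a) - q a\<close>, the converse of subadditivity.\<close>

lemma minimal_sublinear_is_linear:
  assumes q: "sublinear q" and min: "\<And>r. sublinear r \<Longrightarrow> r \<le> q \<Longrightarrow> r = q"
  shows "real_linear q"
proof -
  have descent_eq: "descent a q = q" if "a \<in> carrier E" for a
    using min[OF sublinear_descent[OF q that]] descent_le_self[OF q that] by (simp add: le_fun_def)
  have add: "q (x \<oplus> a) = q x + q a" if "x \<in> carrier E" "a \<in> carrier E" for x a
    using descent_le[OF q that(2,1), of 1] descent_eq[OF that(2)] sublinearD(2)[OF q that] that
    by simp
  have minus: "q (\<ominus> x) = - q x" if "x \<in> carrier E" for x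
    using add[of x "\<ominus> x"] that sublinear_zero[OF q] by (simp add: M.r_neg)
  have "q (complex_of_real t \<odot> x) = t * q x" if x: "x \<in> carrier E" for t x
  proof (cases "0 \<le> t")
    case True
    then show ?thesis by (rule sublinear_scale[OF q x])
  next
    case False
    have "complex_of_real t \<odot> x = complex_of_real (- t) \<odot> (\<ominus> x)"
      using x K_closed(3)[of 1] K_closed(3)[OF of_real_in_K[of t]]
      by (simp add: scale_scale flip: scale_minus_one)
    then show ?thesis
      using sublinear_scale[OF q, of "\<ominus> x" "- t"] False minus[OF x] x by simp
  qed
  then show ?thesis
    using add by (simp add: real_linear_def)
qed

text \<open>In Zorn's lemma for the reversed order, a chain is bounded by its pointwise infimum. This is
  finite because \<open>- p (\<ominus> x)\<close> bounds every sublinear functional below \<open>p\<close>, and it is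
  subadditive because two members of the chain can be replaced by the smaller one.\<close>

lemma minimal_sublinear_exists:
  assumes p: "sublinear p"
  obtains q where "sublinear q" "q \<le> p" "\<And>r. sublinear r \<Longrightarrow> r \<le> q \<Longrightarrow> r = q"
proof -
  define A where "A = {q. sublinear q \<and> q \<le> p}"
  define ge :: "('a \<Rightarrow> real) \<Rightarrow> ('a \<Rightarrow> real) \<Rightarrow> bool" where "ge q r \<longleftrightarrow> r \<le> q" for q r
  have lower: "- p (\<ominus> x) \<le> q x" if "q \<in> A" "x \<in> carrier E" for q x
    using sublinear_lower_bound[of q x] that by (auto simp: A_def le_fun_def intro: order_trans[rotated])
  have "\<exists>q\<in>A. \<forall>r\<in>A. ge q r \<longrightarrow> r = q"
  proof (rule predicate_Zorn)
    show "partial_order_on A (relation_of ge A)"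
      unfolding partial_order_on_def preorder_on_def refl_on_def trans_on_def antisym_def
      by (auto simp: relation_of_def ge_def)
  next
    fix C assume C: "C \<in> Chains (relation_of ge A)"
    then have CA: "C \<subseteq> A"
      by (rule Chains_relation_of)
    show "\<exists>r\<in>A. \<forall>q\<in>C. ge q r"
    proof (cases "C = {}")
      case True
      then show ?thesis using p by (auto simp: A_def)
    next
      case False
      define r where "r x = (INF q\<in>C. q x)" for x
      have off: "q x = 0" if "q \<in> C" "x \<notin> carrier E" for q x
        using that CA by (auto simp: A_def intro: sublinearD(1))
      have "bdd_below ((\<lambda>q. q x) ` C)" for x
      proof (cases "x \<in> carrier E")
        case True
        then show ?thesis using lower CA by (auto intro!: bdd_belowI2)
      next
        case False
        then show ?thesis by (intro bdd_belowI2[where m = 0]) (simp add: off)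
      qed
      then have r_le: "r x \<le> q x" if "q \<in> C" for q x
        using that by (auto simp: r_def intro: cINF_lower)
      have r_greatest: "m \<le> r x" if "\<And>q. q \<in> C \<Longrightarrow> m \<le> q x" for m x
        unfolding r_def using False that by (rule cINF_greatest)
      have subl: "sublinear q" if "q \<in> C" for q
        using that CA by (auto simp: A_def)
      have "sublinear r"
        unfolding sublinear_def
      proof (intro conjI allI ballI impI)
        fix x assume "x \<notin> carrier E"
        then have "r x = (INF q\<in>C. 0)"
          unfolding r_def by (intro INF_cong) (simp_all add: off)
        then show "r x = 0" using False by simp
      next
        fix x y assume xy: "x \<in> carrier E" "y \<in> carrier E"
        have "r (x \<oplus> y) - r y \<le> r x"
        proof (rule r_greatest)
          fix q assume q: "q \<in> C"
          have "r (x \<oplus> y) - q x \<le> r y"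
          proof (rule r_greatest)
            fix q' assume q': "q' \<in> C"
            have "q \<le> q' \<or> q' \<le> q"
              using C q q' by (auto simp: Chains_def relation_of_def ge_def)
            then obtain m where m: "m \<in> C" "m x \<le> q x" "m y \<le> q' y"
              using q q' by (auto simp: le_fun_def)
            then show "r (x \<oplus> y) - q x \<le> q' y"
              using r_le[OF m(1), of "x \<oplus> y"] sublinearD(2)[OF subl[OF m(1)] xy] by simp
          qed
          then show "r (x \<oplus> y) - r y \<le> q x" by simp
        qed
        then show "r (x \<oplus> y) \<le> r x + r y" by simp
      next
        fix t :: real and x assume t: "0 < t" and x: "x \<in> carrier E"
        have "r (complex_of_real t \<odot> x) / t \<le> r x"
        proof (rule r_greatest)
          fix q assume q: "q \<in> C"
          show "r (complex_of_real t \<odot> x) / t \<le> q x"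
            using r_le[OF q, of "complex_of_real t \<odot> x"] sublinearD(3)[OF subl[OF q] t x] t
            by (simp add: field_simps)
        qed
        then show "r (complex_of_real t \<odot> x) \<le> t * r x"
          using t by (simp add: field_simps)
      qed
      moreover have "r \<le> p"
      proof -
        obtain q where "q \<in> C" using False by blast
        then show ?thesis
          using r_le CA unfolding A_def le_fun_def by (blast intro: order_trans)
      qed
      ultimately show ?thesis
        using r_le by (auto simp: A_def ge_def le_fun_def)
    qed
  qed
  then obtain q where "q \<in> A" "\<forall>r\<in>A. r \<le> q \<longrightarrow> r = q"
    by (auto simp: ge_def)
  then show thesis
    using that by (auto simp: A_def)
qed

text \<open>Hahn-Banach for a single vector. Starting the descent at \<open>a\<close> before minimizing forces the value at
  \<open>\<ominus> a\<close> down to \<open>- N a\<close>, so the linear functional below has at least the value \<open>N a\<close> at \<open>a\<close>.\<close>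

lemma norming_real_linear_functional:
  assumes a: "a \<in> carrier E"
  obtains f where "real_linear f" "\<And>x. x \<in> carrier E \<Longrightarrow> \<bar>f x\<bar> \<le> N x" "f a = N a"
proof -
  define p where "p x = (if x \<in> carrier E then N x else 0)" for x
  have p: "sublinear p"
    by (auto simp: sublinear_def p_def norm_triangle norm_scale)
  obtain q where q: "sublinear q" "q \<le> descent a p"
    and min: "\<And>r. sublinear r \<Longrightarrow> r \<le> q \<Longrightarrow> r = q"
    using minimal_sublinear_exists[OF sublinear_descent[OF p a]] by blast
  have lin: "real_linear q"
    by (rule minimal_sublinear_is_linear[OF q(1) min])
  have minus: "q (\<ominus> x) = - q x" if "x \<in> carrier E" for x
  proof -
    have "q (x \<oplus> \<ominus> x) = q x + q (\<ominus> x)"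
      using lin that by (simp add: real_linear_def)
    then show ?thesis
      using sublinear_zero[OF q(1)] that by (simp add: M.r_neg)
  qed
  have le: "q x \<le> N x" if "x \<in> carrier E" for x
    using le_funD[OF q(2), of x] descent_le_self[OF p a, of x] that by (simp add: p_def)
  have "q (\<ominus> a) \<le> descent a p (\<ominus> a)"
    using q(2) by (simp add: le_fun_def)
  also have "\<dots> \<le> - N a"
    using descent_le[OF p a, of "\<ominus> a" 1] a by (simp add: p_def M.l_neg)
  finally have "q a = N a"
    using minus[OF a] le[OF a] by simp
  moreover have "\<bar>q x\<bar> \<le> N x" if "x \<in> carrier E" for x
    using le[OF that] le[of "\<ominus> x"] that by (simp add: minus)
  ultimately show thesis
    using that lin by blast
qed

section \<open>The dual space\<close>


abbreviation "E_dual \<equiv> dual_space K E N"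

abbreviation "E_dual_norm \<equiv> dual_norm E N"

lemma dual_space_simps:
  "u \<in> carrier E_dual \<longleftrightarrow> u \<in> carrier E \<rightarrow>\<^sub>E K \<and>
     (\<forall>x\<in>carrier E. \<forall>y\<in>carrier E. u (x \<oplus> y) = u x + u y) \<and>
     (\<forall>c\<in>K. \<forall>x\<in>carrier E. u (c \<odot> x) = c * u x) \<and>
     (\<exists>B. \<forall>x\<in>carrier E. cmod (u x) \<le> B * N x)"
  "\<zero>\<^bsub>E_dual\<^esub> = (\<lambda>x\<in>carrier E. 0)"
  "u \<oplus>\<^bsub>E_dual\<^esub> v = (\<lambda>x\<in>carrier E. u x + v x)"
  "c \<odot>\<^bsub>E_dual\<^esub> u = (\<lambda>x\<in>carrier E. c * u x)"
  by (simp_all add: dual_space_def)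

lemma functionalD:
  assumes "u \<in> carrier E_dual"
  shows functional_in_K: "x \<in> carrier E \<Longrightarrow> u x \<in> K"
    and functional_extensional: "u \<in> extensional (carrier E)"
    and functional_add: "x \<in> carrier E \<Longrightarrow> y \<in> carrier E \<Longrightarrow> u (x \<oplus> y) = u x + u y"
    and functional_scale: "c \<in> K \<Longrightarrow> x \<in> carrier E \<Longrightarrow> u (c \<odot> x) = c * u x"
  using assms by (auto simp: dual_space_simps PiE_iff)

lemma functional_eqI:
  assumes "u \<in> carrier E_dual" "v \<in> carrier E_dual" "\<And>x. x \<in> carrier E \<Longrightarrow> u x = v x"
  shows "u = v"
  using assms by (auto intro: extensionalityI functional_extensional)

text \<open>In the complex case, rotate \<open>x\<close> so that \<open>u x\<close> becomes a nonnegative real number. The lemma is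
  about functions rather than members of the dual space because it serves to bound a functional that is still
  under construction, and the difference of two functionals.\<close>

lemma norm_le_if_Re_le:
  assumes mem: "\<And>x. x \<in> carrier E \<Longrightarrow> u x \<in> K"
    and scale: "\<And>c x. c \<in> K \<Longrightarrow> x \<in> carrier E \<Longrightarrow> u (c \<odot> x) = c * u x"
    and Re: "\<And>x. x \<in> carrier E \<Longrightarrow> \<bar>Re (u x)\<bar> \<le> B * N x"
    and x: "x \<in> carrier E"
  shows "cmod (u x) \<le> B * N x"
  using real_or_complex
proof
  assume "K = \<real>"
  then have "u x \<in> \<real>" using mem[OF x] by simp
  then have "cmod (u x) = \<bar>Re (u x)\<bar>"
    by (auto elim!: Reals_cases)
  then show ?thesis using Re[OF x] by simp
next
  assume K: "K = UNIV"
  show ?thesis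
  proof (cases "u x = 0")
    case True
    then show ?thesis using Re[OF x] by simp
  next
    case False
    define c where "c = cnj (sgn (u x))"
    have c: "cmod c = 1" using False by (simp add: c_def norm_sgn)
    have "c * u x = u x * cnj (u x) / of_real (cmod (u x))"
      by (simp add: c_def sgn_eq)
    also have "\<dots> = of_real (cmod (u x))"
      using False by (simp add: power2_eq_square flip: complex_norm_square)
    finally have "c * u x = of_real (cmod (u x))" .
    then have "u (c \<odot> x) = of_real (cmod (u x))"
      using scale[of c x] K x by simp
    then show ?thesis
      using Re[of "c \<odot> x"] K x norm_scale[of c x] c by simp
  qed
qed

lemma functional_le_dual_norm:
  assumes u: "u \<in> carrier E_dual" and y: "y \<in> carrier E" "N y \<le> 1"
  shows "cmod (u y) \<le> E_dual_norm u"
proof -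
  obtain B where B: "\<And>x. x \<in> carrier E \<Longrightarrow> cmod (u x) \<le> B * N x"
    using u unfolding dual_space_simps(1) by blast
  have "bdd_above ((\<lambda>x. cmod (u x)) ` {x \<in> carrier E. N x \<le> 1})"
  proof (rule bdd_aboveI2)
    fix x assume x: "x \<in> {x \<in> carrier E. N x \<le> 1}"
    have "cmod (u x) \<le> \<bar>B\<bar> * N x"
      using B[of x] x by (intro order_trans[OF _ mult_right_mono[OF abs_ge_self]]) auto
    also have "\<dots> \<le> \<bar>B\<bar> * 1"
      using x by (intro mult_left_mono) auto
    finally show "cmod (u x) \<le> \<bar>B\<bar>" by simp
  qed
  then show ?thesis
    using y by (auto simp: dual_norm_def intro: cSUP_upper)
qed

lemma dual_norm_nonneg: "u \<in> carrier E_dual \<Longrightarrow> 0 \<le> E_dual_norm u"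
  by (rule order_trans[OF norm_ge_zero functional_le_dual_norm[of u "\<zero>"]]) simp_all

lemma functional_bound:
  assumes u: "u \<in> carrier E_dual" and x: "x \<in> carrier E"
  shows "cmod (u x) \<le> E_dual_norm u * N x"
proof (cases "N x = 0")
  case True
  then have "u x = 0 * u x"
    using functional_scale[OF u in_K_simps(1) x] x by (simp add: norm_eq_0_iff)
  then show ?thesis using True by simp
next
  case False
  then have pos: "0 < N x" using x by (simp add: less_le)
  have "cmod (u (complex_of_real (1 / N x) \<odot> x)) \<le> E_dual_norm u"
    using x pos by (intro functional_le_dual_norm[OF u])
      (simp_all add: norm_scale norm_divide del: of_real_divide)
  then have "cmod (complex_of_real (1 / N x) * u x) \<le> E_dual_norm u"
    by (simp only: functional_scale[OF u of_real_in_K x])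
  then show ?thesis
    using pos by (simp add: norm_mult norm_divide field_simps)
qed

lemma dual_norm_le_iff:
  assumes u: "u \<in> carrier E_dual" and M: "0 \<le> M"
  shows "E_dual_norm u \<le> M \<longleftrightarrow> (\<forall>x\<in>carrier E. cmod (u x) \<le> M * N x)"
proof
  assume "E_dual_norm u \<le> M"
  then show "\<forall>x\<in>carrier E. cmod (u x) \<le> M * N x"
    using functional_bound[OF u] by (meson mult_right_mono norm_nonneg order_trans)
next
  assume L: "\<forall>x\<in>carrier E. cmod (u x) \<le> M * N x"
  show "E_dual_norm u \<le> M"
    unfolding dual_norm_def
  proof (rule cSUP_least)
    show "{x \<in> carrier E. N x \<le> 1} \<noteq> {}"
      by (auto intro!: exI[of _ "\<zero>"])
    fix x assume x: "x \<in> {x \<in> carrier E. N x \<le> 1}"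
    then have "cmod (u x) \<le> M * N x" using L by simp
    also have "\<dots> \<le> M * 1" using x M by (intro mult_left_mono) auto
    finally show "cmod (u x) \<le> M" by simp
  qed
qed

text \<open>Gives closure of the dual space under both of its operations at once.\<close>

lemma functional_linear_combination:
  assumes u: "u \<in> carrier E_dual" and v: "v \<in> carrier E_dual" and c: "c \<in> K"
  shows "(\<lambda>x\<in>carrier E. c * u x + v x) \<in> carrier E_dual"
proof -
  have "cmod (c * u x + v x) \<le> (cmod c * E_dual_norm u + E_dual_norm v) * N x" if "x \<in> carrier E" for x
  proof -
    have "cmod (c * u x + v x) \<le> cmod c * cmod (u x) + cmod (v x)"
      by (metis norm_triangle_ineq norm_mult)
    also have "\<dots> \<le> cmod c * (E_dual_norm u * N x) + E_dual_norm v * N x"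
      using functional_bound[OF u that] functional_bound[OF v that]
      by (intro add_mono mult_left_mono) auto
    finally show ?thesis by (simp add: algebra_simps)
  qed
  moreover have "c * u x + v x \<in> K" if "x \<in> carrier E" for x
    using functional_in_K[OF u that] functional_in_K[OF v that] c by (simp add: K_closed)
  ultimately show ?thesis
    unfolding dual_space_simps
    by (auto simp: functional_add[OF u] functional_add[OF v] functional_scale[OF u]
        functional_scale[OF v] algebra_simps intro!: exI[of _ "cmod c * E_dual_norm u + E_dual_norm v"])
qed

lemma zero_functional: "(\<lambda>x\<in>carrier E. 0) \<in> carrier E_dual"
  by (auto simp: dual_space_simps intro!: exI[of _ 0])

lemma dual_closed:
  "u \<in> carrier E_dual \<Longrightarrow> v \<in> carrier E_dual \<Longrightarrow> u \<oplus>\<^bsub>E_dual\<^esub> v \<in> carrier E_dual"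
  "c \<in> K \<Longrightarrow> u \<in> carrier E_dual \<Longrightarrow> c \<odot>\<^bsub>E_dual\<^esub> u \<in> carrier E_dual"
  using functional_linear_combination[of u v 1]
    functional_linear_combination[of u "\<lambda>x\<in>carrier E. 0" c, OF _ zero_functional]
  by (simp_all add: dual_space_simps(3,4) cong: restrict_cong)

lemma module_dual: "Module.module (scalar_field K) E_dual"
proof (rule moduleI)
  show "cring (scalar_field K)" by (rule R.is_cring)
  show "abelian_group E_dual"
  proof (rule abelian_groupI)
    fix u assume u: "u \<in> carrier E_dual"
    show "\<exists>v\<in>carrier E_dual. v \<oplus>\<^bsub>E_dual\<^esub> u = \<zero>\<^bsub>E_dual\<^esub>"
      using dual_closed(2)[OF K_closed(3)[OF in_K_simps(2)] u]
      by (rule bexI[rotated]) (simp add: dual_space_simps(2-4) cong: restrict_cong)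
    show "\<zero>\<^bsub>E_dual\<^esub> \<oplus>\<^bsub>E_dual\<^esub> u = u"
      using functional_extensional[OF u]
      by (simp add: dual_space_simps(2,3) extensional_restrict cong: restrict_cong)
  qed (use dual_closed zero_functional in
      \<open>auto simp: dual_space_simps(2,3) algebra_simps cong: restrict_cong\<close>)
next
  fix u assume u: "u \<in> carrier E_dual"
  then show "\<one>\<^bsub>scalar_field K\<^esub> \<odot>\<^bsub>E_dual\<^esub> u = u"
    using functional_extensional[OF u]
    by (simp add: scalar_field_def dual_space_simps(4) extensional_restrict cong: restrict_cong)
qed (use dual_closed(2) in
    \<open>auto simp: scalar_field_def dual_space_simps(3,4) algebra_simps cong: restrict_cong\<close>)

lemma normed_space_dual: "normed_space K E_dual E_dual_norm"
proof -
  have eq0: "E_dual_norm u = 0 \<longleftrightarrow> u = \<zero>\<^bsub>E_dual\<^esub>" if u: "u \<in> carrier E_dual" for u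
  proof -
    have "E_dual_norm u = 0 \<longleftrightarrow> (\<forall>x\<in>carrier E. u x = 0)"
      using dual_norm_nonneg[OF u] dual_norm_le_iff[OF u, of 0] by auto
    also have "\<dots> \<longleftrightarrow> u = \<zero>\<^bsub>E_dual\<^esub>"
      using functional_eqI[OF u zero_functional] by (auto simp: dual_space_simps(2))
    finally show ?thesis .
  qed
  have scale_le: "E_dual_norm (c \<odot>\<^bsub>E_dual\<^esub> u) \<le> cmod c * E_dual_norm u"
    if c: "c \<in> K" and u: "u \<in> carrier E_dual" for c u
  proof -
    have "cmod (c * u x) \<le> cmod c * E_dual_norm u * N x" if "x \<in> carrier E" for x
      using functional_bound[OF u that] by (simp add: norm_mult mult.assoc mult_left_mono)
    then show ?thesis
      using dual_norm_le_iff[OF dual_closed(2)[OF c u]] dual_norm_nonneg[OF u]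
      by (simp add: dual_space_simps(4))
  qed
  have scale: "E_dual_norm (c \<odot>\<^bsub>E_dual\<^esub> u) = cmod c * E_dual_norm u"
    if c: "c \<in> K" and u: "u \<in> carrier E_dual" for c u
  proof (cases "c = 0")
    case True
    then show ?thesis
      using scale_le[OF c u] dual_norm_nonneg[OF dual_closed(2)[OF c u]] by simp
  next
    case False
    have ic: "inverse c \<in> K"
      using real_or_complex c by (auto intro: Reals_inverse)
    have "inverse c \<odot>\<^bsub>E_dual\<^esub> (c \<odot>\<^bsub>E_dual\<^esub> u) = u"
      using False functional_extensional[OF u]
      by (simp add: dual_space_simps(4) extensional_restrict mult.assoc[symmetric] cong: restrict_cong)
    then have "E_dual_norm u \<le> inverse (cmod c) * E_dual_norm (c \<odot>\<^bsub>E_dual\<^esub> u)"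
      using scale_le[OF ic dual_closed(2)[OF c u]] by (simp add: norm_inverse)
    then show ?thesis
      using scale_le[OF c u] False by (simp add: field_simps)
  qed
  have triangle: "E_dual_norm (u \<oplus>\<^bsub>E_dual\<^esub> v) \<le> E_dual_norm u + E_dual_norm v"
    if u: "u \<in> carrier E_dual" and v: "v \<in> carrier E_dual" for u v
  proof -
    have "cmod (u x + v x) \<le> (E_dual_norm u + E_dual_norm v) * N x" if "x \<in> carrier E" for x
      using functional_bound[OF u that] functional_bound[OF v that] norm_triangle_ineq[of "u x" "v x"]
      by (simp add: algebra_simps)
    then show ?thesis
      using dual_norm_le_iff[OF dual_closed(1)[OF u v]] dual_norm_nonneg[OF u] dual_norm_nonneg[OF v]
      by (simp add: dual_space_simps(3))
  qed
  show ?thesis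
    using module_dual dual_norm_nonneg eq0 scale triangle by (simp add: normed_space_def)
qed

section \<open>Real parts of functionals\<close>

text \<open>Over the complex numbers the only candidate is \<open>u x = f x - \<i> * f (\<i> \<odot> x)\<close>.\<close>

lemma real_linear_is_Re_functional:
  assumes f: "real_linear f" and B: "\<And>x. x \<in> carrier E \<Longrightarrow> \<bar>f x\<bar> \<le> B * N x"
  obtains u where "u \<in> carrier E_dual" "\<And>x. x \<in> carrier E \<Longrightarrow> Re (u x) = f x"
proof -
  define u where "u = (\<lambda>x\<in>carrier E.
    if K = UNIV then Complex (f x) (- f (\<i> \<odot> x)) else complex_of_real (f x))"
  have mem: "u x \<in> K" if "x \<in> carrier E" for x
    using that by (simp add: u_def)
  have Re: "Re (u x) = f x" if "x \<in> carrier E" for x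
    using that by (simp add: u_def)
  have f_add: "f (x \<oplus> y) = f x + f y" if "x \<in> carrier E" "y \<in> carrier E" for x y
    using f that by (simp add: real_linear_def)
  have f_scale: "f (complex_of_real t \<odot> x) = t * f x" if "x \<in> carrier E" for t x
    using f that by (simp add: real_linear_def)
  have add: "u (x \<oplus> y) = u x + u y" if "x \<in> carrier E" "y \<in> carrier E" for x y
    using that by (auto simp: u_def f_add scale_add_right complex_eq_iff)
  have scale: "u (c \<odot> x) = c * u x" if c: "c \<in> K" and x: "x \<in> carrier E" for c x
  proof (cases "K = UNIV")
    case True
    have "c \<odot> x = complex_of_real (Re c) \<odot> x \<oplus> complex_of_real (Im c) \<odot> (\<i> \<odot> x)"
      using True x by (simp add: scale_scale flip: scale_add_left complex_eq) (metis complex_eq mult.commute)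
    then have 1: "f (c \<odot> x) = Re c * f x + Im c * f (\<i> \<odot> x)"
      using True x by (simp add: f_add f_scale)
    have "\<i> * c = complex_of_real (Re c) * \<i> + complex_of_real (- Im c)"
      by (simp add: complex_eq_iff)
    then have "\<i> \<odot> (c \<odot> x) = complex_of_real (Re c) \<odot> (\<i> \<odot> x) \<oplus> complex_of_real (- Im c) \<odot> x"
      using True x by (simp only: scale_scale UNIV_I scale_add_left)
    then have 2: "f (\<i> \<odot> (c \<odot> x)) = Re c * f (\<i> \<odot> x) - Im c * f x"
      using True x by (simp add: f_add f_scale del: of_real_minus)
    show ?thesis
      using True x by (simp add: u_def 1 2 complex_eq_iff)
  next
    case False
    then have "c \<in> \<real>" using c real_or_complex by simp
    then show ?thesis
      using False x by (auto elim!: Reals_cases simp: u_def f_scale)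
  qed
  have "cmod (u x) \<le> B * N x" if "x \<in> carrier E" for x
    using norm_le_if_Re_le[of u B, OF mem scale _ that] B Re by simp
  moreover have "u \<in> extensional (carrier E)"
    by (simp add: u_def)
  ultimately have "u \<in> carrier E_dual"
    using mem add scale unfolding dual_space_simps(1) by (auto simp: PiE_iff)
  then show thesis using Re that by blast
qed

lemma norming_functional:
  assumes "a \<in> carrier E"
  obtains u where "u \<in> carrier E_dual" "E_dual_norm u \<le> 1" "Re (u a) = N a"
proof -
  obtain f where f: "real_linear f" "\<And>x. x \<in> carrier E \<Longrightarrow> \<bar>f x\<bar> \<le> N x" "f a = N a"
    using norming_real_linear_functional[OF assms] by blast
  obtain u where u: "u \<in> carrier E_dual" "\<And>x. x \<in> carrier E \<Longrightarrow> Re (u x) = f x"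
    using real_linear_is_Re_functional[OF f(1), of 1] f(2) by auto
  have "cmod (u x) \<le> 1 * N x" if "x \<in> carrier E" for x
    using norm_le_if_Re_le[of u 1, OF functional_in_K[OF u(1)] functional_scale[OF u(1)] _ that] u(2) f(2)
    by simp
  then have "E_dual_norm u \<le> 1"
    using dual_norm_le_iff[OF u(1), of 1] by simp
  then show thesis
    using that u f(3) assms by simp
qed


section \<open>Functionals and characters\<close>


abbreviation "char_group \<equiv> dual_group (add_monoid E) N"

abbreviation "char_value \<equiv> dual_value (add_monoid E) N"

abbreviation "to_char \<equiv> functional_to_character E"

lemma to_char_apply [simp]: "x \<in> carrier E \<Longrightarrow> to_char u x = circle_proj (Re (u x))"
  by (simp add: functional_to_character_def)

lemma to_char_mem:
  assumes u: "u \<in> carrier E_dual"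
  shows "to_char u \<in> carrier char_group"
proof -
  have hom: "to_char u \<in> hom (add_monoid E) circle_group"
    by (auto simp: hom_def functional_add[OF u] circle_proj_add)
  have "isCont circle_proj 0"
    using continuous_on_circle_proj[OF continuous_on_id, of UNIV]
    by (simp add: continuous_on_eq_continuous_at)
  then have cont: "\<exists>d>0. \<forall>t. \<bar>t\<bar> < d \<longrightarrow> cmod (circle_proj t - 1) < \<epsilon>" if "\<epsilon> > 0" for \<epsilon>
    using that by (force simp: continuous_at_eps_delta dist_norm)
  have "\<exists>\<delta>>0. \<forall>x\<in>carrier E. N x < \<delta> \<longrightarrow> cmod (to_char u x - 1) < \<epsilon>" if "\<epsilon> > 0" for \<epsilon>
  proof -
    from cont[OF that] obtain d where d: "d > 0" "\<And>t. \<bar>t\<bar> < d \<Longrightarrow> cmod (circle_proj t - 1) < \<epsilon>"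
      by blast
    have pos: "0 < E_dual_norm u + 1"
      using dual_norm_nonneg[OF u] by simp
    have "\<bar>Re (u x)\<bar> < d" if x: "x \<in> carrier E" "N x < d / (E_dual_norm u + 1)" for x
    proof -
      have "\<bar>Re (u x)\<bar> \<le> E_dual_norm u * N x"
        using functional_bound[OF u x(1)] abs_Re_le_cmod[of "u x"] by linarith
      also have "\<dots> \<le> (E_dual_norm u + 1) * N x"
        using x(1) by (intro mult_right_mono) auto
      also have "\<dots> < d"
        using x(2) pos by (simp add: field_simps)
      finally show ?thesis .
    qed
    then show ?thesis
      using d pos by (intro exI[of _ "d / (E_dual_norm u + 1)"]) auto
  qed
  then show ?thesis
    using hom unfolding dual_group_carrier_iff[OF group_value_norm]
    by (simp add: functional_to_character_def)
qed

lemma to_char_hom: "to_char \<in> hom (add_monoid E_dual) char_group"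
proof (rule homI)
  show "to_char (u \<otimes>\<^bsub>add_monoid E_dual\<^esub> v) = to_char u \<otimes>\<^bsub>char_group\<^esub> to_char v" for u v
    by (simp add: functional_to_character_def dual_space_simps(3) circle_proj_add cong: restrict_cong)
qed (simp add: to_char_mem)

lemma functional_eq_if_Re_eq:
  assumes u: "u \<in> carrier E_dual" and v: "v \<in> carrier E_dual"
    and Re: "\<And>x. x \<in> carrier E \<Longrightarrow> Re (u x) = Re (v x)"
  shows "u = v"
proof (rule functional_eqI[OF u v])
  fix x assume x: "x \<in> carrier E"
  have "cmod (u x - v x) \<le> 0 * N x"
  proof (rule norm_le_if_Re_le[where u = "\<lambda>x. u x - v x"])
    show "u x - v x \<in> K" if "x \<in> carrier E" for x
      using functional_in_K[OF u that] functional_in_K[OF v that] real_or_complex by auto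
  qed (use x Re in \<open>auto simp: functional_scale[OF u] functional_scale[OF v] algebra_simps\<close>)
  then show "u x = v x" by simp
qed

lemma to_char_inject:
  assumes u: "u \<in> carrier E_dual" and v: "v \<in> carrier E_dual"
    and eq: "\<And>x. x \<in> carrier E \<Longrightarrow> circle_proj (Re (u x)) = circle_proj (Re (v x))"
  shows "u = v"
proof (rule functional_eq_if_Re_eq[OF u v])
  fix x assume x: "x \<in> carrier E"
  show "Re (u x) = Re (v x)"
  proof (rule circle_proj_scaled_inject)
    show "circle_proj (s * Re (u x)) = circle_proj (s * Re (v x))" for s
      using eq[OF scale_closed[OF of_real_in_K[of s] x]] x
      by (simp add: functional_scale[OF u] functional_scale[OF v])
  qed
qed

text \<open>Along each line \<open>one_parameter_character\<close> supplies a slope \<open>f x\<close>. Additivity and homogeneity of \<open>f\<close> hold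
  because slopes are unique.\<close>

lemma character_lift:
  assumes \<phi>: "\<phi> \<in> carrier char_group"
  obtains f where "real_linear f" "\<And>x. x \<in> carrier E \<Longrightarrow> \<phi> x = circle_proj (f x)"
    "\<exists>B. \<forall>x\<in>carrier E. \<bar>f x\<bar> \<le> B * N x"
proof -
  have hom: "\<phi> \<in> hom (add_monoid E) circle_group"
    and cont: "\<And>\<epsilon>. \<epsilon> > 0 \<Longrightarrow> \<exists>\<delta>>0. \<forall>x\<in>carrier E. N x < \<delta> \<longrightarrow> cmod (\<phi> x - 1) < \<epsilon>"
    using \<phi> unfolding dual_group_carrier_iff[OF group_value_norm] by auto
  have mult: "\<phi> (x \<oplus> y) = \<phi> x * \<phi> y" if "x \<in> carrier E" "y \<in> carrier E" for x y
    using hom that by (auto simp: hom_def)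
  have norm1: "cmod (\<phi> x) = 1" if "x \<in> carrier E" for x
    using hom that by (auto simp: hom_def)
  have "\<exists>t. \<forall>s. \<phi> (complex_of_real s \<odot> x) = circle_proj (s * t)" if x: "x \<in> carrier E" for x
  proof -
    define h where "h s = \<phi> (complex_of_real s \<odot> x)" for s
    have h_mult: "h (s + t) = h s * h t" for s t
      using x by (simp add: h_def scale_add_left mult)
    have h_norm: "cmod (h s) = 1" for s
      using x by (simp add: h_def norm1)
    have "continuous_on UNIV h"
      unfolding continuous_on_eq_continuous_at[OF open_UNIV] continuous_at_eps_delta
    proof (intro ballI allI impI)
      fix s \<epsilon> :: real assume "0 < \<epsilon>"
      then obtain \<delta> where \<delta>: "\<delta> > 0" "\<And>x. x \<in> carrier E \<Longrightarrow> N x < \<delta> \<Longrightarrow> cmod (\<phi> x - 1) < \<epsilon>"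
        using cont by blast
      have "dist (h t) (h s) < \<epsilon>" if "dist t s < \<delta> / (N x + 1)" for t
      proof -
        have "\<bar>t - s\<bar> * N x \<le> \<bar>t - s\<bar> * (N x + 1)"
          by (intro mult_left_mono) auto
        also have "\<dots> < \<delta>"
          using that x norm_nonneg[OF x] by (simp add: dist_norm field_simps)
        finally have "N (complex_of_real (t - s) \<odot> x) < \<delta>"
          using x by (simp add: norm_scale del: of_real_diff)
        then have "cmod (h (t - s) - 1) < \<epsilon>"
          using \<delta>(2) x by (simp add: h_def del: of_real_diff)
        moreover have "h t - h s = h s * (h (t - s) - 1)"
          using h_mult[of s "t - s"] by (simp add: algebra_simps)
        ultimately show ?thesis
          by (simp add: dist_norm norm_mult h_norm)
      qed
      then show "\<exists>d>0. \<forall>t. dist t s < d \<longrightarrow> dist (h t) (h s) < \<epsilon>"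
        using \<delta>(1) norm_nonneg[OF x] by (intro exI[of _ "\<delta> / (N x + 1)"]) auto
    qed
    then obtain t where "\<And>s. h s = circle_proj (s * t)"
      using one_parameter_character[of h] h_mult h_norm by blast
    then show ?thesis by (auto simp: h_def)
  qed
  then obtain f where f: "\<And>x s. x \<in> carrier E \<Longrightarrow> \<phi> (complex_of_real s \<odot> x) = circle_proj (s * f x)"
    by metis
  have lift: "\<phi> x = circle_proj (f x)" if "x \<in> carrier E" for x
    using f[OF that, of 1] that by simp
  have "f (x \<oplus> y) = f x + f y" if x: "x \<in> carrier E" and y: "y \<in> carrier E" for x y
  proof (rule circle_proj_scaled_inject)
    fix s
    have "circle_proj (s * f (x \<oplus> y)) = \<phi> (complex_of_real s \<odot> (x \<oplus> y))"
      using f x y by simp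
    also have "\<dots> = circle_proj (s * f x) * circle_proj (s * f y)"
      using x y by (simp add: scale_add_right mult f)
    finally show "circle_proj (s * f (x \<oplus> y)) = circle_proj (s * (f x + f y))"
      by (simp add: circle_proj_add algebra_simps)
  qed
  moreover have "f (complex_of_real t \<odot> x) = t * f x" if x: "x \<in> carrier E" for t x
  proof (rule circle_proj_scaled_inject)
    fix s
    have "circle_proj (s * f (complex_of_real t \<odot> x)) = \<phi> (complex_of_real (s * t) \<odot> x)"
      using f[of "complex_of_real t \<odot> x" s] x by (simp add: scale_scale)
    then show "circle_proj (s * f (complex_of_real t \<odot> x)) = circle_proj (s * (t * f x))"
      using f[OF x, of "s * t"] by (simp add: mult.assoc)
  qed
  ultimately have lin: "real_linear f"
    by (auto simp: real_linear_def)
  obtain \<delta> where \<delta>: "\<delta> > 0" "\<And>x. x \<in> carrier E \<Longrightarrow> N x < \<delta> \<Longrightarrow> cmod (\<phi> x - 1) < 1"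
    using cont[of 1] by auto
  have half: "circle_proj (1 / 2) = - 1"
    by (simp add: circle_proj_def exp_eq_polar)
  \<comment> \<open>If \<open>f x\<close> were too large, then a multiple of \<open>x\<close> inside the \<open>\<delta>\<close>-ball would be sent to \<open>-1\<close>.\<close>
  have "\<bar>f x\<bar> \<le> 1 / \<delta> * N x" if x: "x \<in> carrier E" for x
  proof (rule ccontr)
    assume "\<not> ?thesis"
    then have big: "N x < \<delta> * \<bar>f x\<bar>"
      using \<delta>(1) by (simp add: field_simps)
    then have fx: "0 < \<bar>f x\<bar>"
      using \<delta>(1) norm_nonneg[OF x] by (metis less_le_trans mult_pos_pos mult_zero_right not_less abs_ge_zero less_le)
    define s where "s = 1 / (2 * f x)"
    have "N (complex_of_real s \<odot> x) = \<bar>s\<bar> * N x"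
      using x by (simp add: norm_scale)
    also have "\<dots> = N x / (2 * \<bar>f x\<bar>)"
      by (simp add: s_def abs_mult)
    also have "\<dots> < \<delta>"
    proof -
      have "N x < 2 * (\<delta> * \<bar>f x\<bar>)"
        using big mult_pos_pos[OF \<delta>(1) fx] by linarith
      then have "N x < \<delta> * (2 * \<bar>f x\<bar>)"
        by (simp only: mult.left_commute)
      then show ?thesis
        using fx by (simp add: pos_divide_less_eq)
    qed
    finally have "cmod (\<phi> (complex_of_real s \<odot> x) - 1) < 1"
      using \<delta>(2) x by simp
    moreover have "\<phi> (complex_of_real s \<odot> x) = - 1"
      using f[OF x, of s] fx half by (simp add: s_def)
    ultimately show False by simp
  qed
  then show thesis
    using that lin lift by blast
qed

lemma to_char_surj:
  assumes "\<phi> \<in> carrier char_group"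
  obtains u where "u \<in> carrier E_dual" "to_char u = \<phi>"
proof -
  obtain f B where f: "real_linear f" "\<And>x. x \<in> carrier E \<Longrightarrow> \<phi> x = circle_proj (f x)"
    "\<And>x. x \<in> carrier E \<Longrightarrow> \<bar>f x\<bar> \<le> B * N x"
    using character_lift[OF assms] by metis
  obtain u where u: "u \<in> carrier E_dual" "\<And>x. x \<in> carrier E \<Longrightarrow> Re (u x) = f x"
    using real_linear_is_Re_functional[OF f(1), of B] f(3) by blast
  have "to_char u = \<phi>"
  proof (rule extensionalityI)
    show "\<phi> \<in> extensional (carrier E)"
      using assms by (simp add: dual_group_def)
  qed (auto simp: functional_to_character_def u f)
  then show thesis using that u by blast
qed

lemma to_char_image: "to_char ` carrier E_dual = carrier char_group"
proof (intro equalityI subsetI)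
  show "\<phi> \<in> to_char ` carrier E_dual" if "\<phi> \<in> carrier char_group" for \<phi>
    using to_char_surj[OF that] by blast
qed (use to_char_mem in blast)

lemma to_char_iso: "to_char \<in> iso (add_monoid E_dual) char_group"
proof (rule isoI[OF to_char_hom])
  have "inj_on to_char (carrier E_dual)"
  proof (rule inj_onI)
    fix u v assume uv: "u \<in> carrier E_dual" "v \<in> carrier E_dual" "to_char u = to_char v"
    show "u = v"
      using to_char_apply uv(3) by (intro to_char_inject uv) metis
  qed
  then show "bij_betw to_char (carrier (add_monoid E_dual)) (carrier char_group)"
    by (simp add: bij_betw_def to_char_image)
qed

text \<open>Both sides are the least \<open>M\<close> in an estimate valid for all \<open>x\<close>; replacing \<open>x\<close> by small multiples turns
  the estimate on the circle into one for \<open>Re u\<close>, and rotating turns that into one for \<open>u\<close>.\<close>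

lemma char_value_to_char:
  assumes u: "u \<in> carrier E_dual"
  shows "char_value (to_char u) = E_dual_norm u"
proof (rule dual_value_eqI)
  show "0 \<le> E_dual_norm u" by (rule dual_norm_nonneg[OF u])
  fix M :: real assume M: "0 < M"
  show "(\<forall>x\<in>carrier (add_monoid E). circle_abs (to_char u x) \<le> M * N x) \<longleftrightarrow> E_dual_norm u \<le> M"
  proof
    assume L: "\<forall>x\<in>carrier (add_monoid E). circle_abs (to_char u x) \<le> M * N x"
    have "\<bar>Re (u x)\<bar> \<le> M * N x" if x: "x \<in> carrier E" for x
    proof (rule abs_le_if_circle_abs_scaled_le)
      fix s :: real assume s: "0 < s"
      have "circle_abs (to_char u (complex_of_real s \<odot> x)) \<le> M * N (complex_of_real s \<odot> x)"
        using L x by simp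
      then show "circle_abs (circle_proj (s * Re (u x))) \<le> s * (M * N x)"
        using x s by (simp add: functional_scale[OF u] norm_scale algebra_simps)
    qed
    then show "E_dual_norm u \<le> M"
      using dual_norm_le_iff[OF u, of M] M
        norm_le_if_Re_le[of u M, OF functional_in_K[OF u] functional_scale[OF u]] by auto
  next
    assume R: "E_dual_norm u \<le> M"
    show "\<forall>x\<in>carrier (add_monoid E). circle_abs (to_char u x) \<le> M * N x"
    proof
      fix x assume "x \<in> carrier (add_monoid E)"
      then have x: "x \<in> carrier E" by simp
      have "circle_abs (circle_proj (Re (u x))) \<le> \<bar>Re (u x)\<bar>"
        by (rule circle_abs_circle_proj_le)
      also have "\<dots> \<le> cmod (u x)" by (rule abs_Re_le_cmod)
      also have "\<dots> \<le> M * N x"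
        using R dual_norm_le_iff[OF u, of M] M x by simp
      finally show "circle_abs (to_char u x) \<le> M * N x"
        using x by simp
    qed
  qed
qed

lemma to_char_zero: "to_char \<zero>\<^bsub>E_dual\<^esub> = \<one>\<^bsub>char_group\<^esub>"
  by (simp add: functional_to_character_def dual_space_simps(2) cong: restrict_cong)

lemma dual_locale: "real_or_complex_normed_space K E_dual E_dual_norm"
  using real_or_complex normed_space_dual by unfold_locales

lemma group_value_char_value: "group_value char_group char_value"
proof (rule group_value_iso[OF _ to_char_iso])
  show "group_value (add_monoid E_dual) E_dual_norm"
    by (rule real_or_complex_normed_space.group_value_norm[OF dual_locale])
qed (simp_all add: to_char_zero char_value_to_char del: dual_group_simps)


section \<open>Regularity\<close>

abbreviation "eval_char \<equiv> canonical_hom (add_monoid E) N"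

text \<open>The same scaling argument, now in the dual space, shows that a bound \<open>M\<close> for the evaluation at
  \<open>a\<close> bounds \<open>\<bar>Re (u a)\<bar>\<close> by \<open>M\<close> for \<open>u\<close> in the unit ball; a norming functional then gives
  \<open>N a \<le> M\<close>.\<close>

lemma regular: "regular_metric_group (add_monoid E) N"
proof -
  have "bidual_value (add_monoid E) N (eval_char a) = N a" if a: "a \<in> carrier E" for a
  proof (rule dual_value_eqI)
    show "0 \<le> N a" using a by simp
    fix M :: real assume M: "0 < M"
    have "(\<forall>\<phi>\<in>carrier char_group. circle_abs (eval_char a \<phi>) \<le> M * char_value \<phi>)
        \<longleftrightarrow> (\<forall>u\<in>carrier E_dual. circle_abs (circle_proj (Re (u a))) \<le> M * E_dual_norm u)"
      using a by (simp add: canonical_hom_def char_value_to_char flip: to_char_image)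
    also have "\<dots> \<longleftrightarrow> N a \<le> M"
    proof
      assume L: "\<forall>u\<in>carrier E_dual. circle_abs (circle_proj (Re (u a))) \<le> M * E_dual_norm u"
      obtain u where u: "u \<in> carrier E_dual" "E_dual_norm u \<le> 1" "Re (u a) = N a"
        using norming_functional[OF a] by blast
      have "\<bar>Re (u a)\<bar> \<le> M"
      proof (rule abs_le_if_circle_abs_scaled_le)
        fix s :: real assume s: "0 < s"
        interpret dual: real_or_complex_normed_space K E_dual E_dual_norm by (rule dual_locale)
        have "circle_abs (circle_proj (Re ((complex_of_real s \<odot>\<^bsub>E_dual\<^esub> u) a)))
            \<le> M * E_dual_norm (complex_of_real s \<odot>\<^bsub>E_dual\<^esub> u)"
          using L dual_closed(2)[OF of_real_in_K u(1)] by blast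
        also have "\<dots> \<le> M * (s * 1)"
          using u s M dual.norm_scale[OF of_real_in_K u(1), of s] by (intro mult_left_mono) auto
        finally show "circle_abs (circle_proj (s * Re (u a))) \<le> s * M"
          using a by (simp add: dual_space_simps(4) mult.commute)
      qed
      then show "N a \<le> M" using u(3) by simp
    next
      assume R: "N a \<le> M"
      show "\<forall>u\<in>carrier E_dual. circle_abs (circle_proj (Re (u a))) \<le> M * E_dual_norm u"
      proof
        fix u assume u: "u \<in> carrier E_dual"
        have "circle_abs (circle_proj (Re (u a))) \<le> \<bar>Re (u a)\<bar>"
          by (rule circle_abs_circle_proj_le)
        also have "\<dots> \<le> cmod (u a)" by (rule abs_Re_le_cmod)
        also have "\<dots> \<le> E_dual_norm u * N a" by (rule functional_bound[OF u a])
        also have "\<dots> \<le> M * E_dual_norm u"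
          using mult_left_mono[OF R dual_norm_nonneg[OF u]] by (simp add: mult.commute)
        finally show "circle_abs (circle_proj (Re (u a))) \<le> M * E_dual_norm u" .
      qed
    qed
    finally show "(\<forall>\<phi>\<in>carrier char_group. circle_abs (eval_char a \<phi>) \<le> M * char_value \<phi>) \<longleftrightarrow> N a \<le> M" .
  qed
  then show ?thesis
    using group_value_norm M.a_comm_group
    by (simp add: regular_metric_group_def metric_abelian_group_def)
qed

section \<open>Reflexivity\<close>


abbreviation "eval_functional \<equiv> canonical_embedding K E N"

lemma functional_minus:
  assumes "u \<in> carrier E_dual" "x \<in> carrier E"
  shows "u (\<ominus> x) = - u x"
  using functional_scale[OF assms(1) K_closed(3)[OF in_K_simps(2)] assms(2)] assms(2)
  by (simp add: scale_minus_one)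

lemma eval_functional_mem:
  assumes a: "a \<in> carrier E"
  shows "eval_functional a \<in> carrier (bidual_space K E N)"
proof -
  interpret dual: real_or_complex_normed_space K E_dual E_dual_norm by (rule dual_locale)
  have "\<forall>u\<in>carrier E_dual. cmod (eval_functional a u) \<le> N a * E_dual_norm u"
    using functional_bound[OF _ a] by (simp add: canonical_embedding_def mult.commute)
  moreover have "eval_functional a \<in> carrier E_dual \<rightarrow>\<^sub>E K"
    using functional_in_K[OF _ a] by (auto simp: canonical_embedding_def)
  ultimately show ?thesis
    using a unfolding dual.dual_space_simps(1)
    by (auto simp: canonical_embedding_def dual_closed) (auto simp: dual_space_simps(3,4))
qed

text \<open>The composite \<open>J\<close> of \<open>\<Psi> \<mapsto> circle_proj \<circ> Re \<Psi>\<close> for the dual space with the pullback along the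
  inverse of \<^const>\<open>functional_to_character\<close> is a bijection from the bidual space onto the bidual
  group. It takes evaluations to evaluations, so it matches the images of \<open>E\<close> in the two biduals.\<close>

lemma eval_char_image_iff:
  "eval_char ` carrier E = carrier (bidual_group (add_monoid E) N) \<longleftrightarrow>
    eval_functional ` carrier E = carrier (bidual_space K E N)"
proof -
  interpret dual: real_or_complex_normed_space K E_dual E_dual_norm by (rule dual_locale)
  define from_char where "from_char = inv_into (carrier E_dual) to_char"
  define J where "J \<Psi> = (\<lambda>\<phi>\<in>carrier char_group. dual.to_char \<Psi> (from_char \<phi>))" for \<Psi>
  have inj: "inj_on to_char (carrier E_dual)"
    using to_char_iso by (simp add: iso_def bij_betw_def)
  have from_to: "from_char (to_char u) = u" if "u \<in> carrier E_dual" for u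
    using inj that by (simp add: from_char_def)
  have from_mem: "from_char \<phi> \<in> carrier E_dual" and to_from: "to_char (from_char \<phi>) = \<phi>"
    if "\<phi> \<in> carrier char_group" for \<phi>
    using that by (simp_all add: from_char_def inv_into_into f_inv_into_f flip: to_char_image)
  have from_hom: "from_char \<in> hom char_group (add_monoid E_dual)"
    using group.iso_set_sym[OF dual.M.a_group to_char_iso] by (simp add: from_char_def iso_def)
  have from_value: "E_dual_norm (from_char \<phi>) = char_value \<phi>" if "\<phi> \<in> carrier char_group" for \<phi>
    using char_value_to_char[OF from_mem[OF that]] to_from[OF that] by simp
  have J_mem: "J \<Psi> \<in> carrier (bidual_group (add_monoid E) N)" if "\<Psi> \<in> carrier dual.E_dual" for \<Psi>
    unfolding J_def
    by (rule dual_group_pullback[OF group_value_char_value dual.group_value_norm from_hom])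
      (use from_value dual.to_char_mem[OF that] in auto)
  have J_inj: "inj_on J (carrier dual.E_dual)"
  proof (rule inj_onI)
    fix \<Psi> \<Psi>' assume \<Psi>: "\<Psi> \<in> carrier dual.E_dual" "\<Psi>' \<in> carrier dual.E_dual" "J \<Psi> = J \<Psi>'"
    show "\<Psi> = \<Psi>'"
    proof (rule dual.to_char_inject[OF \<Psi>(1,2)])
      fix u assume u: "u \<in> carrier E_dual"
      then show "circle_proj (Re (\<Psi> u)) = circle_proj (Re (\<Psi>' u))"
        using fun_cong[OF \<Psi>(3), of "to_char u"] to_char_mem[OF u] by (simp add: J_def from_to)
    qed
  qed
  have J_surj: "J ` carrier dual.E_dual = carrier (bidual_group (add_monoid E) N)"
  proof (intro equalityI subsetI)
    fix \<Phi> assume \<Phi>: "\<Phi> \<in> carrier (bidual_group (add_monoid E) N)"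
    have "(\<lambda>u\<in>carrier (add_monoid E_dual). \<Phi> (to_char u)) \<in> carrier dual.char_group"
      by (rule dual_group_pullback[OF dual.group_value_norm group_value_char_value to_char_hom _ \<Phi>])
        (simp add: char_value_to_char)
    then obtain \<Psi> where \<Psi>: "\<Psi> \<in> carrier dual.E_dual"
      "dual.to_char \<Psi> = (\<lambda>u\<in>carrier (add_monoid E_dual). \<Phi> (to_char u))"
      by (rule dual.to_char_surj)
    have "J \<Psi> = \<Phi>"
    proof (rule extensionalityI)
      show "\<Phi> \<in> extensional (carrier char_group)"
        using \<Phi> by (simp add: dual_group_def)
      show "J \<Psi> \<phi> = \<Phi> \<phi>" if "\<phi> \<in> carrier char_group" for \<phi>
        using that by (simp add: J_def \<Psi>(2) from_mem to_from del: dual.to_char_apply)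
    qed (simp add: J_def)
    then show "\<Phi> \<in> J ` carrier dual.E_dual"
      using \<Psi>(1) by blast
  qed (use J_mem in blast)
  have J_eval: "J (eval_functional a) = eval_char a" if "a \<in> carrier E" for a
  proof (rule extensionalityI)
    fix \<phi> assume \<phi>: "\<phi> \<in> carrier char_group"
    have "J (eval_functional a) \<phi> = to_char (from_char \<phi>) a"
      using \<phi> that from_mem[OF \<phi>] by (simp add: J_def canonical_embedding_def)
    then show "J (eval_functional a) \<phi> = eval_char a \<phi>"
      using \<phi> by (simp add: to_from canonical_hom_def del: to_char_apply)
  qed (simp_all add: J_def canonical_hom_def)
  have "eval_char ` carrier E = J ` (eval_functional ` carrier E)"
    unfolding image_image by (rule image_cong[OF refl]) (simp add: J_eval)
  moreover have "eval_functional ` carrier E \<subseteq> carrier dual.E_dual"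
    using eval_functional_mem by blast
  ultimately show ?thesis
    using inj_on_image_eq_iff[OF J_inj _ subset_refl] by (simp add: J_surj)
qed

text \<open>The limit of a Cauchy sequence is found as the point that represents the pointwise limit of its evaluations, and
  norming functionals turn pointwise convergence with a uniform Cauchy estimate into convergence in norm.\<close>

lemma complete_if_eval_functional_surj:
  assumes surj: "eval_functional ` carrier E = carrier (bidual_space K E N)"
  shows "Metric_space.mcomplete (carrier E) (value_dist (add_monoid E) N)"
proof -
  interpret dual: real_or_complex_normed_space K E_dual E_dual_norm by (rule dual_locale)
  interpret mE: Metric_space "carrier E" "value_dist (add_monoid E) N"
    using group_value_norm by (simp add: group_value_def)
  have dist: "value_dist (add_monoid E) N x y = N (\<ominus> x \<oplus> y)"
    if "x \<in> carrier E" "y \<in> carrier E" for x y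
    using that by (simp add: value_dist_def flip: a_inv_def)
  have functional_diff: "u (\<ominus> x \<oplus> y) = u y - u x"
    if "u \<in> carrier E_dual" "x \<in> carrier E" "y \<in> carrier E" for u x y
    using that by (simp add: functional_add functional_minus)
  show ?thesis
    unfolding mE.mcomplete_def
  proof (intro allI impI)
    fix \<sigma> assume "mE.MCauchy \<sigma>"
    then have \<sigma>: "\<And>n. \<sigma> n \<in> carrier E"
      and cauchy: "\<And>\<epsilon>. \<epsilon> > 0 \<Longrightarrow> \<exists>k. \<forall>n\<ge>k. \<forall>m\<ge>k. N (\<ominus> (\<sigma> n) \<oplus> \<sigma> m) < \<epsilon>"
      unfolding mE.MCauchy_def by (auto simp: dist range_subsetD)
    have "Cauchy (\<lambda>n. u (\<sigma> n))" if u: "u \<in> carrier E_dual" for u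
    proof (rule CauchyI)
      fix \<epsilon> :: real assume "0 < \<epsilon>"
      then obtain k where k: "\<And>n m. n \<ge> k \<Longrightarrow> m \<ge> k \<Longrightarrow>
          N (\<ominus> (\<sigma> n) \<oplus> \<sigma> m) < \<epsilon> / (E_dual_norm u + 1)"
        using cauchy[of "\<epsilon> / (E_dual_norm u + 1)"] dual_norm_nonneg[OF u] by auto
      have "cmod (u (\<sigma> m) - u (\<sigma> n)) < \<epsilon>" if "m \<ge> k" "n \<ge> k" for m n
      proof -
        have "cmod (u (\<ominus> (\<sigma> n) \<oplus> \<sigma> m)) \<le> E_dual_norm u * N (\<ominus> (\<sigma> n) \<oplus> \<sigma> m)"
          using \<sigma> by (intro functional_bound[OF u]) simp
        also have "\<dots> \<le> (E_dual_norm u + 1) * N (\<ominus> (\<sigma> n) \<oplus> \<sigma> m)"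
          using \<sigma> by (intro mult_right_mono) auto
        also have "\<dots> < \<epsilon>"
          using k[OF that(2,1)] dual_norm_nonneg[OF u] by (simp add: field_simps)
        finally show ?thesis
          using \<sigma> by (simp add: functional_diff[OF u])
      qed
      then show "\<exists>k. \<forall>m\<ge>k. \<forall>n\<ge>k. norm (u (\<sigma> m) - u (\<sigma> n)) < \<epsilon>" by blast
    qed
    then have "\<exists>l. (\<lambda>n. u (\<sigma> n)) \<longlonglongrightarrow> l" if "u \<in> carrier E_dual" for u
      using that by (simp add: Cauchy_convergent_iff convergent_def)
    then obtain l where l: "\<And>u. u \<in> carrier E_dual \<Longrightarrow> (\<lambda>n. u (\<sigma> n)) \<longlonglongrightarrow> l u"
      by metis
    obtain k1 where k1: "\<And>n. n \<ge> k1 \<Longrightarrow> N (\<ominus> (\<sigma> k1) \<oplus> \<sigma> n) < 1"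
      using cauchy[of 1] by auto
    have bound: "N (\<sigma> n) \<le> N (\<sigma> k1) + 1" if "n \<ge> k1" for n
    proof -
      have "\<sigma> n = \<sigma> k1 \<oplus> (\<ominus> (\<sigma> k1) \<oplus> \<sigma> n)"
        using \<sigma> by (simp add: M.r_neg2)
      then show ?thesis
        using norm_triangle[of "\<sigma> k1" "\<ominus> (\<sigma> k1) \<oplus> \<sigma> n"] k1[OF that] \<sigma> by simp
    qed
    \<comment> \<open>The values of \<open>l\<close> outside the dual space are arbitrary, while members of the bidual space are extensional.\<close>
    define L where "L = (\<lambda>u\<in>carrier E_dual. l u)"
    have "closed K" using real_or_complex closed_complex_Reals by auto
    then have L_mem: "L \<in> carrier E_dual \<rightarrow>\<^sub>E K"
      using closed_sequentially[OF _ _ l] functional_in_K \<sigma> by (auto simp: L_def)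
    have L_add: "L (u \<oplus>\<^bsub>E_dual\<^esub> v) = L u + L v"
      if u: "u \<in> carrier E_dual" and v: "v \<in> carrier E_dual" for u v
    proof (rule LIMSEQ_unique)
      show "(\<lambda>n. (u \<oplus>\<^bsub>E_dual\<^esub> v) (\<sigma> n)) \<longlonglongrightarrow> L (u \<oplus>\<^bsub>E_dual\<^esub> v)"
        using l dual_closed(1)[OF u v] by (simp add: L_def)
      show "(\<lambda>n. (u \<oplus>\<^bsub>E_dual\<^esub> v) (\<sigma> n)) \<longlonglongrightarrow> L u + L v"
        using tendsto_add[OF l[OF u] l[OF v]] u v \<sigma> by (simp add: L_def dual_space_simps(3))
    qed
    have L_scale: "L (c \<odot>\<^bsub>E_dual\<^esub> u) = c * L u"
      if c: "c \<in> K" and u: "u \<in> carrier E_dual" for c u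
    proof (rule LIMSEQ_unique)
      show "(\<lambda>n. (c \<odot>\<^bsub>E_dual\<^esub> u) (\<sigma> n)) \<longlonglongrightarrow> L (c \<odot>\<^bsub>E_dual\<^esub> u)"
        using l dual_closed(2)[OF c u] by (simp add: L_def)
      show "(\<lambda>n. (c \<odot>\<^bsub>E_dual\<^esub> u) (\<sigma> n)) \<longlonglongrightarrow> c * L u"
        using tendsto_mult_left[OF l[OF u], of c] u \<sigma> by (simp add: L_def dual_space_simps(4))
    qed
    have L_bound: "cmod (L u) \<le> (N (\<sigma> k1) + 1) * E_dual_norm u" if u: "u \<in> carrier E_dual" for u
    proof (rule LIMSEQ_le_const2)
      show "(\<lambda>n. cmod (u (\<sigma> n))) \<longlonglongrightarrow> cmod (L u)"
        using tendsto_norm[OF l[OF u]] u by (simp add: L_def)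
      have "cmod (u (\<sigma> n)) \<le> (N (\<sigma> k1) + 1) * E_dual_norm u" if "n \<ge> k1" for n
        using functional_bound[OF u \<sigma>, of n] mult_left_mono[OF bound[OF that] dual_norm_nonneg[OF u]]
        by (simp add: mult.commute)
      then show "\<exists>k. \<forall>n\<ge>k. cmod (u (\<sigma> n)) \<le> (N (\<sigma> k1) + 1) * E_dual_norm u" by blast
    qed
    have "L \<in> carrier (bidual_space K E N)"
      unfolding dual.dual_space_simps(1) using L_mem L_add L_scale L_bound by blast
    then obtain a where a: "a \<in> carrier E" "L = eval_functional a"
      using surj by blast
    have lim: "(\<lambda>n. u (\<sigma> n)) \<longlonglongrightarrow> u a" if "u \<in> carrier E_dual" for u
      using l[OF that] fun_cong[OF a(2), of u] that by (simp add: L_def canonical_embedding_def)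
    have "limitin mE.mtopology \<sigma> a sequentially"
      unfolding mE.limit_metric_sequentially
    proof (intro conjI allI impI)
      fix \<epsilon> :: real assume \<epsilon>: "0 < \<epsilon>"
      then obtain k where k: "\<And>n m. n \<ge> k \<Longrightarrow> m \<ge> k \<Longrightarrow> N (\<ominus> (\<sigma> n) \<oplus> \<sigma> m) < \<epsilon> / 2"
        using cauchy[of "\<epsilon> / 2"] by auto
      have "N (\<ominus> (\<sigma> n) \<oplus> a) \<le> \<epsilon> / 2" if n: "n \<ge> k" for n
      proof -
        obtain u where u: "u \<in> carrier E_dual" "E_dual_norm u \<le> 1"
          "Re (u (\<ominus> (\<sigma> n) \<oplus> a)) = N (\<ominus> (\<sigma> n) \<oplus> a)"
          using norming_functional[of "\<ominus> (\<sigma> n) \<oplus> a"] \<sigma> a(1) by auto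
        have "Re (u (\<ominus> (\<sigma> n) \<oplus> a)) \<le> \<epsilon> / 2"
        proof (rule LIMSEQ_le_const2)
          show "(\<lambda>m. Re (u (\<ominus> (\<sigma> n) \<oplus> \<sigma> m))) \<longlonglongrightarrow> Re (u (\<ominus> (\<sigma> n) \<oplus> a))"
            using tendsto_Re[OF tendsto_diff[OF lim[OF u(1)] tendsto_const[of "u (\<sigma> n)"]]] \<sigma> a(1)
            by (simp add: functional_diff[OF u(1)])
          have "Re (u (\<ominus> (\<sigma> n) \<oplus> \<sigma> m)) \<le> \<epsilon> / 2" if m: "m \<ge> k" for m
          proof -
            have "Re (u (\<ominus> (\<sigma> n) \<oplus> \<sigma> m)) \<le> cmod (u (\<ominus> (\<sigma> n) \<oplus> \<sigma> m))"
              by (rule complex_Re_le_cmod)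
            also have "\<dots> \<le> 1 * N (\<ominus> (\<sigma> n) \<oplus> \<sigma> m)"
              using u(2) dual_norm_le_iff[OF u(1), of 1] \<sigma> by simp
            finally show ?thesis using k[OF n m] by simp
          qed
          then show "\<exists>k. \<forall>m\<ge>k. Re (u (\<ominus> (\<sigma> n) \<oplus> \<sigma> m)) \<le> \<epsilon> / 2" by blast
        qed
        then show ?thesis using u(3) by simp
      qed
      then show "\<exists>k. \<forall>n\<ge>k. \<sigma> n \<in> carrier E \<and> value_dist (add_monoid E) N (\<sigma> n) a < \<epsilon>"
        using \<sigma> a(1) \<epsilon> by (intro exI[of _ k]) (force simp: dist)
    qed (rule a(1))
    then show "\<exists>a. limitin mE.mtopology \<sigma> a sequentially" by blast
  qed
qed

lemma reflexive_iff: "reflexive_metric_group (add_monoid E) N \<longleftrightarrow> reflexive_banach_space K E N"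
  unfolding reflexive_metric_group_def reflexive_banach_space_def banach_space_def
  using regular eval_char_image_iff complete_if_eval_functional_surj normed by auto

end

theorem theorem2p8:
  fixes K :: "complex set" and E :: "(complex, 'a) module" and N :: "'a \<Rightarrow> real"
  assumes "K = \<real> \<or> K = UNIV"
    and "normed_space K E N"
  shows "regular_metric_group (add_monoid E) N \<and>
    functional_to_character E
      \<in> iso (add_monoid (dual_space K E N)) (dual_group (add_monoid E) N) \<and>
    (\<forall>u\<in>carrier (dual_space K E N).
      dual_value (add_monoid E) N (functional_to_character E u) = dual_norm E N u) \<and>
    (reflexive_metric_group (add_monoid E) N \<longleftrightarrow> reflexive_banach_space K E N)"
proof -
  interpret real_or_complex_normed_space K E N
    using assms by unfold_locales
  show ?thesis
    using regular to_char_iso char_value_to_char reflexive_iff by blast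
qed

end
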